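(* Let $(\mathsf{Z},\mathsf{A},p,c)$ be a Markov decision process such that $\mathsf{Z}$ and $\mathsf{A}$ are compact, $c$ is a bounded continuous real function on $\mathsf{Z}\times\mathsf{A}$, and the stochastic kernel $p(\,\cdot\,|z,a)$ is weakly continuous in $(z,a)$. Let $\beta\in(0,1)$. For each $n\ge 1$ let MDP$_n$ be the finite-state model described in the context, let $f_n^*:\mathsf{Z}_n\to\mathsf{A}$ be an optimal deterministic stationary policy of MDP$_n$ for the $\beta$-discounted cost, and let $\hat f_n=f_n^*\circ Q_n:\mathsf{Z}\to\mathsf{A}$ be its extension to $\mathsf{Z}$. Then $$\lim_{n\to\infty}\|J(\hat f_n,\,\cdot\,)-J^*\|=0,$$ where $J(\hat f_n,\cdot)$ is the $\beta$-discounted cost of $\hat f_n$ in the original MDP and $J^*$ is the discounted value function of the original MDP.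
   Context: A Markov decision process (MDP) $(\mathsf{Z},\mathsf{A},p,c)$ consists of Borel spaces $\mathsf{Z}$ (states) and $\mathsf{A}$ (actions, all admissible in every state), a stochastic kernel $p(dy|z,a)$ on $\mathsf{Z}$ given $\mathsf{Z}\times\mathsf{A}$ (the transition probability), and a measurable one-stage cost $c:\mathsf{Z}\times\mathsf{A}\to\mathbb{R}$. A policy $\pi=\{\pi_t\}$ is a sequence of stochastic kernels on $\mathsf{A}$ given the histories $(z_0,a_0,\dots,z_{t-1},a_{t-1},z_t)$; $\Pi$ is the set of all policies. A deterministic stationary policy is a measurable function $f$ from states to actions, applied as $a_t=f(z_t)$. $\mathbb{E}_z^\pi$ is the expectation under policy $\pi$ started at $z$. The discounted cost is $J(\pi,z)=\mathbb{E}_z^\pi[\sum_{t\ge0}\beta^t c(z_t,a_t)]$ and $J^*(z)=\inf_{\pi\in\Pi}J(\pi,z)$. A policy is optimal if its cost equals the value function at every initial state. $\|\cdot\|$ is the sup norm. Weak continuity of $p$: $p(\cdot|z_k,a_k)\to p(\cdot|z,a)$ weakly whenever $(z_k,a_k)\to(z,a)$. Finite-state models: let $d_{\mathsf{Z}}$ be the metric on $\mathsf{Z}$. For each $n\ge1$ fix a finite set $\mathsf{Z}_n=\{z_{n,1},\dots,z_{n,k_n}\}\subset\mathsf{Z}$ with $\min_i d_{\mathsf{Z}}(z,z_{n,i})<1/n$ for all $z\in\mathsf{Z}$, and $Q_n:\mathsf{Z}\to\mathsf{Z}_n$, $Q_n(z)=\arg\min_{z_{n,i}}d_{\mathsf{Z}}(z,z_{n,i})$,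 with ties broken so that $Q_n$ is measurable. Let $\mathcal{S}_{n,i}=\{z:Q_n(z)=z_{n,i}\}$. Let $\nu_n$ be any probability measure on $\mathsf{Z}$ with $\nu_n(\mathcal{S}_{n,i})>0$ for all $i$, and let $\nu_{n,i}$ be the probability measure on $\mathcal{S}_{n,i}$ given by $\nu_{n,i}(\cdot)=\nu_n(\cdot)/\nu_n(\mathcal{S}_{n,i})$. MDP$_n$ has state space $\mathsf{Z}_n$, action space $\mathsf{A}$, one-stage cost $c_n(z_{n,i},a)=\int_{\mathcal{S}_{n,i}}c(z,a)\,\nu_{n,i}(dz)$ and transition probability $p_n(z_{n,j}|z_{n,i},a)=\int_{\mathcal{S}_{n,i}}p(\mathcal{S}_{n,j}|z,a)\,\nu_{n,i}(dz)$. Under the hypotheses an optimal deterministic stationary policy of MDP$_n$ exists. *)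

theory Defs
  imports "HOL-Probability.Probability"
begin

text \<open>
  State and action spaces are measurable spaces, so that a model on a topological space (with
  \<^term>\<open>borel\<close>) and a model on a finite set of points of the same type (with
  \<^term>\<open>count_space Y\<close>, which for finite \<open>Y\<close> is the trace Borel space) are instances of
  one notion. The Borel-space requirement is not part of \<open>is_mdp\<close>; it is carried by
  the instances.
\<close>

record ('z, 'a) mdp =
  states :: "'z measure"
  actions :: "'a measure"
  transition :: "'z \<times> 'a \<Rightarrow> 'z measure"
  cost :: "'z \<times> 'a \<Rightarrow> real"

definition is_mdp :: "('z, 'a) mdp \<Rightarrow> bool" where
  "is_mdp M \<longleftrightarrow>
     transition M \<in> states M \<Otimes>\<^sub>M actions M \<rightarrow>\<^sub>M prob_algebra (states M) \<and>
     cost M \<in> borel_measurable (states M \<Otimes>\<^sub>M actions M)"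

text \<open>
  The history \<open>(z\<^sub>0, a\<^sub>0, \<dots>, z\<^bsub>t-1\<^esub>, a\<^bsub>t-1\<^esub>, z\<^sub>t)\<close> is encoded as a pair: the function
  \<open>i \<mapsto> (z\<^sub>i, a\<^sub>i)\<close> on \<open>{0..<t}\<close>, and the current state \<open>z\<^sub>t\<close>.
\<close>

type_synonym ('z, 'a) policy = "nat \<Rightarrow> (nat \<Rightarrow> 'z \<times> 'a) \<times> 'z \<Rightarrow> 'a measure"

definition policies :: "('z, 'a) mdp \<Rightarrow> ('z, 'a) policy set" where
  "policies M = {\<pi>. \<forall>t. \<pi> t \<in>
     (PiM {0..<t} (\<lambda>_. states M \<Otimes>\<^sub>M actions M)) \<Otimes>\<^sub>M states M \<rightarrow>\<^sub>M prob_algebra (actions M)}"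

definition stationary :: "('z, 'a) mdp \<Rightarrow> ('z \<Rightarrow> 'a) \<Rightarrow> ('z, 'a) policy" where
  "stationary M f = (\<lambda>t (h, z). return (actions M) (f z))"

text \<open>
  \<open>step M \<pi> z\<^sub>0 t h\<close> is the conditional law of \<open>(z\<^sub>t, a\<^sub>t)\<close> given the earlier pairs \<open>h\<close>;
  \<open>trajectory\<close> is the law of the whole process \<open>((z\<^sub>t, a\<^sub>t))\<^sub>t\<close> supplied by the
  Ionescu-Tulcea theorem.
\<close>

definition step ::
  "('z, 'a) mdp \<Rightarrow> ('z, 'a) policy \<Rightarrow> 'z \<Rightarrow> nat \<Rightarrow> (nat \<Rightarrow> 'z \<times> 'a) \<Rightarrow> ('z \<times> 'a) measure" where
  "step M \<pi> z0 t h =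
     (if t = 0 then return (states M) z0 else transition M (h (t - 1))) \<bind>
     (\<lambda>z. \<pi> t (h, z) \<bind> (\<lambda>a. return (states M \<Otimes>\<^sub>M actions M) (z, a)))"

definition trajectory ::
  "('z, 'a) mdp \<Rightarrow> ('z, 'a) policy \<Rightarrow> 'z \<Rightarrow> (nat \<Rightarrow> 'z \<times> 'a) measure" where
  "trajectory M \<pi> z0 = projective_family.lim UNIV
     (Ionescu_Tulcea.CI (step M \<pi> z0) (\<lambda>_. states M \<Otimes>\<^sub>M actions M))
     (\<lambda>_. states M \<Otimes>\<^sub>M actions M)"

definition discounted_cost ::
  "('z, 'a) mdp \<Rightarrow> real \<Rightarrow> ('z, 'a) policy \<Rightarrow> 'z \<Rightarrow> real" where
  "discounted_cost M \<beta> \<pi> z = (\<integral>\<omega>. (\<Sum>t. \<beta> ^ t * cost M (\<omega> t)) \<partial>trajectory M \<pi> z)"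

definition value_function :: "('z, 'a) mdp \<Rightarrow> real \<Rightarrow> 'z \<Rightarrow> real" where
  "value_function M \<beta> z = (INF \<pi>\<in>policies M. discounted_cost M \<beta> \<pi> z)"

definition optimal_stationary :: "('z, 'a) mdp \<Rightarrow> real \<Rightarrow> ('z \<Rightarrow> 'a) \<Rightarrow> bool" where
  "optimal_stationary M \<beta> f \<longleftrightarrow>
     f \<in> states M \<rightarrow>\<^sub>M actions M \<and>
     (\<forall>z\<in>space (states M). discounted_cost M \<beta> (stationary M f) z = value_function M \<beta> z)"

definition weakly_converges ::
  "(nat \<Rightarrow> 'z::topological_space measure) \<Rightarrow> 'z measure \<Rightarrow> bool" where
  "weakly_converges \<mu>s \<mu> \<longleftrightarrow>
     (\<forall>g::'z \<Rightarrow> real. continuous_on UNIV g \<and> bounded (range g) \<longrightarrow>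
        (\<lambda>k. \<integral>y. g y \<partial>\<mu>s k) \<longlonglongrightarrow> (\<integral>y. g y \<partial>\<mu>))"

definition weakly_continuous_kernel ::
  "('x::topological_space \<Rightarrow> 'z::topological_space measure) \<Rightarrow> bool" where
  "weakly_continuous_kernel p \<longleftrightarrow>
     (\<forall>X x. X \<longlonglongrightarrow> x \<longrightarrow> weakly_converges (\<lambda>k. p (X k)) (p x))"

text \<open>
  For \<open>y \<in> Y\<close> the cell of \<open>y\<close> is \<^term>\<open>Q -` {y}\<close>, and
  \<^term>\<open>uniform_measure \<nu> (Q -` {y})\<close> is \<open>\<nu>\<close> conditioned on that cell
  (no uniformity of \<open>\<nu>\<close> is involved).
\<close>

definition finite_model ::
  "('z, 'a) mdp \<Rightarrow> 'z set \<Rightarrow> ('z \<Rightarrow> 'z) \<Rightarrow> 'z measure \<Rightarrow> ('z, 'a) mdp" where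
  "finite_model M Y Q \<nu> =
     \<lparr> states = count_space Y,
       actions = actions M,
       transition = (\<lambda>(y, a). point_measure Y (\<lambda>y'.
         ennreal (LINT z:Q -` {y}|uniform_measure \<nu> (Q -` {y}).
           measure (transition M (z, a)) (Q -` {y'})))),
       cost = (\<lambda>(y, a).
         LINT z:Q -` {y}|uniform_measure \<nu> (Q -` {y}). cost M (z, a)) \<rparr>"

text \<open>
  The library constants for the Ionescu-Tulcea measure are meaningful only under their locale
  assumptions; these hold for every admissible policy, and the finite models are again MDPs.
\<close>

lemma stationary_policy:
  assumes f[measurable]: "f \<in> states M \<rightarrow>\<^sub>M actions M"
  shows "stationary M f \<in> policies M"
proof -
  have "(\<lambda>x. return (actions M) (f (snd x))) \<in> N \<Otimes>\<^sub>M states M \<rightarrow>\<^sub>M prob_algebra (actions M)" for N :: "'c measure"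
    by (rule measurable_compose[OF _ measurable_return_prob_space]) measurable
  then show ?thesis
    by (simp add: policies_def stationary_def case_prod_beta')
qed

lemma step_Ionescu_Tulcea:
  assumes "is_mdp M" "\<pi> \<in> policies M" and z: "z \<in> space (states M)"
  shows "Ionescu_Tulcea (step M \<pi> z) (\<lambda>_. states M \<Otimes>\<^sub>M actions M)"
proof -
  let ?N = "states M \<Otimes>\<^sub>M actions M"
  let ?H = "\<lambda>t. PiM {0..<t::nat} (\<lambda>_. ?N)"
  have T: "transition M \<in> ?N \<rightarrow>\<^sub>M prob_algebra (states M)"
    using assms(1) by (simp add: is_mdp_def)
  have P: "\<pi> t \<in> ?H t \<Otimes>\<^sub>M states M \<rightarrow>\<^sub>M prob_algebra (actions M)" for t
    using assms(2) by (simp add: policies_def)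
  have inner: "(\<lambda>x. \<pi> t x \<bind> (\<lambda>a. return ?N (snd x, a))) \<in> ?H t \<Otimes>\<^sub>M states M \<rightarrow>\<^sub>M prob_algebra ?N" for t
  proof (rule measurable_bind_prob_space2[OF P])
    have "(\<lambda>w. (snd (fst w), snd w)) \<in> (?H t \<Otimes>\<^sub>M states M) \<Otimes>\<^sub>M actions M \<rightarrow>\<^sub>M ?N"
      by (intro measurable_Pair measurable_compose[OF measurable_fst measurable_snd] measurable_snd)
    from measurable_compose[OF this measurable_return_prob_space]
    show "(\<lambda>(x, a). return ?N (snd x, a)) \<in> (?H t \<Otimes>\<^sub>M states M) \<Otimes>\<^sub>M actions M \<rightarrow>\<^sub>M prob_algebra ?N"
      by (simp add: case_prod_beta')
  qed
  have first: "(\<lambda>h. if t = 0 then return (states M) z else transition M (h (t - 1))) \<in> ?H t \<rightarrow>\<^sub>M prob_algebra (states M)" for t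
  proof (cases t)
    case 0
    have "return (states M) z \<in> space (prob_algebra (states M))"
      using z by (simp add: space_prob_algebra prob_space_return)
    then show ?thesis using 0 by simp
  next
    case (Suc n)
    have "(\<lambda>h. h n) \<in> ?H t \<rightarrow>\<^sub>M ?N" by (rule measurable_component_singleton) (simp add: Suc)
    from measurable_compose[OF this T] show ?thesis using Suc by simp
  qed
  have *: "step M \<pi> z t \<in> ?H t \<rightarrow>\<^sub>M prob_algebra ?N" for t
  proof -
    have e: "step M \<pi> z t = (\<lambda>h. (if t = 0 then return (states M) z else transition M (h (t - 1))) \<bind>
     (\<lambda>z. \<pi> t (h, z) \<bind> (\<lambda>a. return ?N (z, a))))" by (rule ext) (simp only: step_def)
    show ?thesis unfolding e
      by (rule measurable_bind_prob_space2[OF first]) (use inner[of t] in \<open>simp add: case_prod_beta'\<close>)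
  qed
  show ?thesis
  proof (rule Ionescu_Tulcea.intro)
    fix i x
    show "step M \<pi> z i \<in> ?H i \<rightarrow>\<^sub>M subprob_algebra ?N"
      using * by (rule measurable_prob_algebraD)
    assume "x \<in> space (?H i)"
    from measurable_space[OF * this] show "prob_space (step M \<pi> z i x)"
      by (simp add: space_prob_algebra)
  qed
qed

lemma finite_model_is_mdp:
  fixes M :: "('z::polish_space, 'a::polish_space) mdp"
  assumes M: "is_mdp M" "states M = borel" "actions M = borel"
    and Y: "finite Y" and Q: "Q \<in> borel \<rightarrow>\<^sub>M count_space Y"
    and nu: "prob_space \<nu>" "sets \<nu> = sets borel"
      "\<And>y. y \<in> Y \<Longrightarrow> measure \<nu> (Q -` {y}) > 0"
  shows "is_mdp (finite_model M Y Q \<nu>)"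
proof -
  have T[measurable]: "transition M \<in> borel \<Otimes>\<^sub>M borel \<rightarrow>\<^sub>M prob_algebra borel"
   and C[measurable]: "cost M \<in> borel_measurable (borel \<Otimes>\<^sub>M borel)"
    using M by (auto simp: is_mdp_def)
  have T'[measurable]: "transition M \<in> borel \<Otimes>\<^sub>M borel \<rightarrow>\<^sub>M subprob_algebra borel" using T by (rule measurable_prob_algebraD)
  have cell[measurable]: "Q -` {y} \<in> sets borel" if "y\<in>Y" for y
    using measurable_sets[OF Q, of "{y}"] that by simp
  have U: "prob_space (uniform_measure \<nu> (Q -` {y}))" if "y\<in>Y" for y
  proof (rule prob_space_uniform_measure)
    show "emeasure \<nu> (Q -` {y}) \<noteq> 0" using nu(3)[OF that] by (metis less_irrefl measure_eq_emeasure_eq_ennreal measure_def enn2real_0)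
    show "emeasure \<nu> (Q -` {y}) \<noteq> \<infinity>" using finite_measure.emeasure_finite[OF prob_space.finite_measure[OF nu(1)]] by simp
  qed
  have sU[measurable_cong]: "sets (uniform_measure \<nu> (Q -` {y})) = sets borel" for y using nu by simp
  have m: "(\<lambda>a. LINT z:Q -` {y}|uniform_measure \<nu> (Q -` {y}). g (z,a)) \<in> borel_measurable borel"
    if "y \<in> Y" and [measurable]: "g \<in> borel_measurable (borel \<Otimes>\<^sub>M (borel :: 'a measure))" for y and g :: "_ \<Rightarrow> real"
  proof -
    interpret prob_space "uniform_measure \<nu> (Q -` {y})" by (rule U) fact
    note cell[OF that(1), measurable]
    show ?thesis unfolding set_lebesgue_integral_def by measurable
  qed
  have cm[measurable]: "(\<lambda>x. measure (transition M x) (Q -` {y'})) \<in> borel_measurable (borel \<Otimes>\<^sub>M borel)" if "y'\<in>Y" for y'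
     using cell[OF that] by measurable
  have tot: "(\<Sum>y'\<in>Y. LINT z:Q -` {y}|uniform_measure \<nu> (Q -` {y}). measure (transition M (z, a)) (Q -` {y'})) = 1" if "y \<in> Y" for y a
  proof -
    interpret prob_space "uniform_measure \<nu> (Q -` {y})" by (rule U) fact
    have ps: "prob_space (transition M (z,a))" "sets (transition M (z,a)) = sets borel" for z
      using measurable_space[OF T, of "(z,a)"] by (auto simp: space_pair_measure space_prob_algebra)
    have one: "(\<Sum>y'\<in>Y. measure (transition M (z, a)) (Q -` {y'})) = 1" for z
    proof -
      interpret p: prob_space "transition M (z,a)" by (rule ps)
      have "(\<Sum>y'\<in>Y. measure (transition M (z, a)) (Q -` {y'})) = measure (transition M (z, a)) (\<Union>y'\<in>Y. Q -` {y'})"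
        using Y cell by (intro p.finite_measure_finite_Union[symmetric]) (auto simp: ps disjoint_family_on_def)
      also have "(\<Union>y'\<in>Y. Q -` {y'}) = space (transition M (z, a))"
        using measurable_space[OF Q] sets_eq_imp_space_eq[OF ps(2)] by auto
      finally show ?thesis using p.prob_space by simp
    qed
    have int: "integrable (uniform_measure \<nu> (Q -` {y})) (\<lambda>z. indicat_real (Q -` {y}) z *\<^sub>R measure (transition M (z, a)) (Q -` {y'}))" if y': "y' \<in> Y" for y'
    proof (rule integrable_const_bound[where B=1])
      have "(\<lambda>z. measure (transition M (z, a)) (Q -` {y'})) \<in> borel_measurable borel"
        by (rule measurable_compose[OF _ cm[OF y']]) simp
      moreover have "(indicat_real (Q -` {y})) \<in> borel_measurable borel" using cell[OF \<open>y \<in> Y\<close>] by simp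
      ultimately have "(\<lambda>z. indicat_real (Q -` {y}) z *\<^sub>R measure (transition M (z, a)) (Q -` {y'})) \<in> borel_measurable borel"
        by (rule borel_measurable_scaleR[rotated])
      then show "(\<lambda>z. indicat_real (Q -` {y}) z *\<^sub>R measure (transition M (z, a)) (Q -` {y'})) \<in> borel_measurable (uniform_measure \<nu> (Q -` {y}))"
        by (simp add: measurable_cong_sets[OF sU refl])
    qed (simp add: indicator_def prob_space.prob_le_1[OF ps(1)])
    have "(\<Sum>y'\<in>Y. LINT z:Q -` {y}|uniform_measure \<nu> (Q -` {y}). measure (transition M (z, a)) (Q -` {y'})) =
       (LINT z|uniform_measure \<nu> (Q -` {y}). (\<Sum>y'\<in>Y. indicat_real (Q -` {y}) z *\<^sub>R measure (transition M (z, a)) (Q -` {y'})))"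
      unfolding set_lebesgue_integral_def
      by (rule Bochner_Integration.integral_sum[symmetric]) (rule int)
    also have "\<dots> = (LINT z|uniform_measure \<nu> (Q -` {y}). indicat_real (Q -` {y}) z)"
      by (simp add: sum_distrib_left[symmetric] one)
    also have "\<dots> = 1"
      using nu(3)[OF that] cell[OF that] nu(1,2) sets_eq_imp_space_eq[OF nu(2)]
      by (simp add: measure_uniform_measure finite_measure.emeasure_eq_measure[OF prob_space.finite_measure])
    finally show ?thesis .
  qed
  show ?thesis unfolding is_mdp_def
  proof
    show "cost (finite_model M Y Q \<nu>) \<in> borel_measurable (states (finite_model M Y Q \<nu>) \<Otimes>\<^sub>M actions (finite_model M Y Q \<nu>))"
      using Y m[OF _ C] by (auto simp: finite_model_def M intro!: measurable_pair_measure_countable1 countable_finite)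
    show "transition (finite_model M Y Q \<nu>) \<in> states (finite_model M Y Q \<nu>) \<Otimes>\<^sub>M actions (finite_model M Y Q \<nu>) \<rightarrow>\<^sub>M prob_algebra (states (finite_model M Y Q \<nu>))"
      apply (simp add: finite_model_def M)
      apply (rule measurable_pair_measure_countable1)
      using Y apply (simp add: countable_finite)
      apply (rule measurable_prob_algebraI)
      apply (simp, rule prob_spaceI)
      subgoal for y a
        using Y tot[of y a]
        by (simp add: space_point_measure emeasure_point_measure_finite sum_ennreal set_lebesgue_integral_def)
      subgoal for y
        apply simp
        apply (rule measurable_subprob_algebra)
        subgoal for a using Y tot[of y a]
          by (intro prob_space_imp_subprob_space prob_spaceI)(simp add: space_point_measure emeasure_point_measure_finite sum_ennreal set_lebesgue_integral_def)
        apply (simp add: sets_point_measure)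
        subgoal for A
          apply (simp add: emeasure_point_measure_finite Y)
          apply (rule borel_measurable_sum)
          using m[OF _ cm, of y] by (auto intro!: measurable_compose[OF _ measurable_ennreal])
        done
      done
  qed
qed

end

theory Submission
  imports Defs
begin

text \<open>
  Let \<open>v\<close> be the continuous solution of the Bellman equation of the original model and let
  \<open>r(z, a) = c(z, a) + \<beta> \<integral> v dp(\<sqdot>|z, a) - v(z)\<close> be its residual, so that \<open>r \<ge> 0\<close> with
  equality at a minimising action. In every model and under every policy \<open>\<pi>\<close>, telescoping gives
  \<open>J(\<pi>, z) - v(z) = \<Sum>\<^sub>t \<beta>\<^sup>t E r(z\<^sub>t, a\<^sub>t)\<close> with the residual \<open>r\<close> of that model. By uniform continuity the residual of
  \<open>v\<close> in the finite model differs uniformly little from \<open>r\<close>, so the minimising actions bound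
  the optimal cost of the finite model from above by \<open>v\<close> up to a small error. Since all its
  residuals are almost nonnegative, the residual of \<open>v\<close> along the optimal \<open>f\<^sub>n\<close> must be small.
  Uniform continuity carries this over to \<open>r(z, f\<^sub>n(Q\<^sub>n z))\<close>, and telescoping in the original
  model bounds \<open>J(f\<^sub>n \<circ> Q\<^sub>n, \<sqdot>) - v\<close>.
\<close>

section \<open>Marginals of the Ionescu-Tulcea measure\<close>

text \<open>The almost sure bound already makes \<open>g\<close> integrable. With
  \<open>k = 0\<close> this bounds a mean; with \<open>k\<close> a value at a point it compares a
  cell average with that value.\<close>

lemma (in prob_space) abs_expectation_diff_le:
  fixes g :: "'a \<Rightarrow> real"
  assumes g: "g \<in> borel_measurable M" and e: "AE x in M. \<bar>g x - k\<bar> \<le> e"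
  shows "\<bar>expectation g - k\<bar> \<le> e"
proof -
  have "integrable M (\<lambda>x. g x - k)"
    using g e by (intro integrable_const_bound[where B=e]) auto
  then have int: "integrable M g"
    using Bochner_Integration.integrable_add[of M "\<lambda>x. g x - k" "\<lambda>_. k"] by simp
  have "AE x in M. g x \<le> k + e" "AE x in M. k - e \<le> g x"
    using e by (auto elim!: eventually_mono)
  then have "expectation g \<le> k + e" "k - e \<le> expectation g"
    by (auto intro: integral_le_const[OF int] integral_ge_const[OF int])
  then show ?thesis by simp
qed

text \<open>Coordinate \<open>t\<close> factors through the restriction to
  \<open>{0..<Suc t}\<close>, where the projective limit agrees with the finite-horizon measure it
  extends.\<close>

lemma (in Ionescu_Tulcea) distr_lim_component:
  "distr PF.lim (M t) (\<lambda>\<omega>. \<omega> t) = distr (C 0 (Suc t) (\<lambda>_. undefined)) (M t) (\<lambda>x. x t)"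
proof -
  let ?J = "{0..<Suc t}" and ?u = "\<lambda>_. undefined"
  have u: "?u \<in> space (PiM {0..<0} M)" by simp
  \<comment> \<open>\<open>CI\<close> on \<open>?J\<close> is projected from the least horizon
    containing \<open>?J\<close>, which is exactly \<open>Suc t\<close>, so no later kernel
    enters.\<close>
  have up: "up_to ?J = Suc t"
    using up_to_less[of ?J t] by (intro antisym) (simp_all add: up_to_iff)
  have comp: "(\<lambda>x. x t) \<in> PiM ?J M \<rightarrow>\<^sub>M M t"
    by (rule measurable_component_singleton) simp
  have "distr PF.lim (M t) (\<lambda>\<omega>. \<omega> t) = distr (distr PF.lim (PiM ?J M) (\<lambda>x. restrict x ?J)) (M t) (\<lambda>x. x t)"
    by (subst distr_distr[OF comp]) (simp_all add: measurable_cong_sets[OF PF.sets_lim refl] comp_def measurable_restrict_subset)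
  also have "\<dots> = distr (distr (C 0 (Suc t) ?u) (PiM ?J M) (\<lambda>x. restrict x ?J)) (M t) (\<lambda>x. x t)"
    unfolding distr_lim[OF finite_atLeastLessThan] CI_def up ..
  also have "\<dots> = distr (C 0 (Suc t) ?u) (M t) (\<lambda>x. x t)"
    by (subst distr_distr[OF comp])
      (simp_all add: measurable_cong_sets[OF sets_C[OF u] refl] comp_def measurable_restrict_subset del: C.simps)
  finally show ?thesis .
qed

text \<open>The last coordinate of a history is the one just drawn from \<open>P t\<close>:
  \<open>eP t h\<close> appends a draw from \<open>P t h\<close> at index \<open>t\<close>, and
  reading index \<open>t\<close> undoes the appending.\<close>

lemma (in Ionescu_Tulcea) distr_C_component:
  "distr (C 0 (Suc t) (\<lambda>_. undefined)) (M t) (\<lambda>x. x t) = C 0 t (\<lambda>_. undefined) \<bind> P t"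
proof -
  let ?J = "{0..<Suc t}" and ?u = "\<lambda>_. undefined"
  have u: "?u \<in> space (PiM {0..<0} M)" by simp
  have comp: "(\<lambda>x. x t) \<in> PiM ?J M \<rightarrow>\<^sub>M M t"
    by (rule measurable_component_singleton) simp
  have "distr (C 0 (Suc t) ?u) (M t) (\<lambda>x. x t) = C 0 t ?u \<bind> (\<lambda>h. distr (eP t h) (M t) (\<lambda>x. x t))"
    unfolding C.simps add_0
    using prob_space.not_empty[OF prob_space_C[OF u, of t]]
    by (intro distr_bind[of _ _ "PiM ?J M"] comp) (simp_all add: measurable_cong_sets[OF sets_C[OF u] refl])
  also have "\<dots> = C 0 t ?u \<bind> P t"
  proof (rule bind_cong[OF refl])
    fix h assume "h \<in> space (C 0 t ?u)"
    then have h: "h \<in> space (PiM {0..<t} M)" by (simp add: space_C[OF u])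
    have "(\<lambda>x. h(t := x)) \<in> P t h \<rightarrow>\<^sub>M PiM ?J M"
      using h by (intro measurable_fun_upd[where J="{0..<t}"] measurable_const measurable_ident_sets)
        (auto simp: sets_P)
    then have "distr (eP t h) (M t) (\<lambda>x. x t) = distr (P t h) (M t) (\<lambda>x. x)"
      unfolding eP_def by (subst distr_distr[OF comp]) (simp_all add: comp_def)
    then show "distr (eP t h) (M t) (\<lambda>x. x t) = P t h"
      by (simp add: distr_id2 sets_P[OF h])
  qed
  finally show ?thesis .
qed

lemma (in Ionescu_Tulcea) integral_lim_component:
  fixes g :: "'a \<Rightarrow> real"
  assumes g: "g \<in> borel_measurable (M t)" and B: "\<And>x. x \<in> space (M t) \<Longrightarrow> \<bar>g x\<bar> \<le> B"
  shows "(\<integral>\<omega>. g (\<omega> t) \<partial>PF.lim) = (\<integral>h. (\<integral>x. g x \<partial>P t h) \<partial>C 0 t (\<lambda>_. undefined))"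
proof -
  have u: "(\<lambda>_. undefined) \<in> space (PiM {0..<0} M)" by simp
  interpret C: prob_space "C 0 t (\<lambda>_. undefined)" by (rule prob_space_C[OF u])
  have "(\<integral>\<omega>. g (\<omega> t) \<partial>PF.lim) = (\<integral>x. g x \<partial>distr PF.lim (M t) (\<lambda>\<omega>. \<omega> t))"
    by (rule integral_distr[OF _ g, symmetric]) (simp add: measurable_cong_sets[OF PF.sets_lim refl])
  also have "\<dots> = (\<integral>h. (\<integral>x. g x \<partial>P t h) \<partial>C 0 t (\<lambda>_. undefined))"
    unfolding distr_lim_component distr_C_component
  proof (rule integral_bind[OF g B, where B'=1])
    show "P t \<in> C 0 t (\<lambda>_. undefined) \<rightarrow>\<^sub>M subprob_algebra (M t)"
      using P[of t] by (simp add: measurable_cong_sets[OF sets_C[OF u] refl])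
    show "AE h in C 0 t (\<lambda>_. undefined). emeasure (P t h) (space (P t h)) \<le> ennreal 1"
      using prob_space_P by (intro AE_I2) (simp add: space_C[OF u] prob_space.emeasure_space_1)
  qed (simp_all add: C.finite_measure_axioms)
  finally show ?thesis .
qed

text \<open>Turns an integral over finite histories back into one over trajectories, for use when
  the law of the state at time \<open>Suc t\<close> reads the entry \<open>h t\<close>.\<close>

lemma (in Ionescu_Tulcea) integral_C_component:
  fixes g :: "'a \<Rightarrow> real"
  assumes g: "g \<in> borel_measurable (M t)"
  shows "(\<integral>h. g (h t) \<partial>C 0 (Suc t) (\<lambda>_. undefined)) = (\<integral>\<omega>. g (\<omega> t) \<partial>PF.lim)"
proof -
  have u: "(\<lambda>_. undefined) \<in> space (PiM {0..<0} M)" by simp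
  have "(\<integral>h. g (h t) \<partial>C 0 (Suc t) (\<lambda>_. undefined)) =
      (\<integral>x. g x \<partial>distr (C 0 (Suc t) (\<lambda>_. undefined)) (M t) (\<lambda>x. x t))"
    by (rule integral_distr[OF _ g, symmetric])
      (simp add: measurable_cong_sets[OF sets_C[OF u] refl] measurable_component_singleton del: C.simps)
  also have "\<dots> = (\<integral>\<omega>. g (\<omega> t) \<partial>PF.lim)"
    unfolding distr_lim_component[symmetric]
    by (rule integral_distr[OF _ g]) (simp add: measurable_cong_sets[OF PF.sets_lim refl])
  finally show ?thesis .
qed

text \<open>Projecting onto no coordinates preserves total mass, and the image law is a member of
  the projective family.\<close>

lemma (in Ionescu_Tulcea) prob_space_lim: "prob_space PF.lim"
proof -
  have "prob_space (distr PF.lim (PiM {} M) (\<lambda>x. restrict x {}))"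
    unfolding distr_lim[OF finite.emptyI] by (rule PF.prob_space_P) auto
  then show ?thesis
    by (rule prob_space_distrD[rotated]) (auto simp: measurable_cong_sets[OF PF.sets_lim refl] intro!: measurable_restrict)
qed

section \<open>Discounted costs and Bellman residuals\<close>

text \<open>The Bellman error of \<open>u\<close> at a single state-action pair: no minimum over
  actions is taken, so it can be averaged along the trajectory of any policy.\<close>

definition bellman_residual :: "('z, 'a) mdp \<Rightarrow> real \<Rightarrow> ('z \<Rightarrow> real) \<Rightarrow> 'z \<times> 'a \<Rightarrow> real" where
  "bellman_residual M \<beta> u x = cost M x + \<beta> * (\<integral>y. u y \<partial>transition M x) - u (fst x)"

section \<open>Processes under an arbitrary policy\<close>

locale controlled_process =
  fixes M :: "('z, 'a) mdp" and \<pi> :: "('z, 'a) policy" and z0 :: 'z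
  assumes mdp: "is_mdp M" and policy: "\<pi> \<in> policies M" and initial: "z0 \<in> space (states M)"
begin

abbreviation N where "N \<equiv> states M \<Otimes>\<^sub>M actions M"
abbreviation H where "H t \<equiv> PiM {0..<t::nat} (\<lambda>_. N)"

text \<open>The state half of \<open>step\<close>, split off so that state and action can be
  integrated one after the other.\<close>

definition state_law where
  "state_law t h = (if t = 0 then return (states M) z0 else transition M (h (t - 1)))"

sublocale Ionescu_Tulcea "step M \<pi> z0" "\<lambda>_. N"
  by (rule step_Ionescu_Tulcea[OF mdp policy initial])

lemma trajectory_eq: "trajectory M \<pi> z0 = PF.lim"
  by (simp add: trajectory_def)

lemma transition_measurable: "transition M \<in> N \<rightarrow>\<^sub>M prob_algebra (states M)"
  and cost_measurable: "cost M \<in> borel_measurable N"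
  using mdp by (simp_all add: is_mdp_def)

lemma state_law_prob:
  assumes h: "h \<in> space (H t)"
  shows "state_law t h \<in> space (prob_algebra (states M))"
proof (cases t)
  case 0
  then show ?thesis using initial by (simp add: state_law_def space_prob_algebra prob_space_return)
next
  case (Suc n)
  then have "h n \<in> space N" using h by (auto simp: space_PiM)
  from measurable_space[OF transition_measurable this] Suc show ?thesis by (simp add: state_law_def)
qed

lemma action_law_prob:
  "h \<in> space (H t) \<Longrightarrow> z \<in> space (states M) \<Longrightarrow> \<pi> t (h, z) \<in> space (prob_algebra (actions M))"
  using policy measurable_space[of "\<pi> t" "H t \<Otimes>\<^sub>M states M" "prob_algebra (actions M)" "(h, z)"]
  by (simp add: policies_def space_pair_measure)

lemma state_action_measurable:
  assumes h: "h \<in> space (H t)"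
  shows "(\<lambda>z. \<pi> t (h, z) \<bind> (\<lambda>a. return N (z, a))) \<in> states M \<rightarrow>\<^sub>M prob_algebra N"
proof (rule measurable_bind_prob_space2)
  have "(\<lambda>z. (h, z)) \<in> states M \<rightarrow>\<^sub>M H t \<Otimes>\<^sub>M states M" using h by simp
  then show "(\<lambda>z. \<pi> t (h, z)) \<in> states M \<rightarrow>\<^sub>M prob_algebra (actions M)"
    by (rule measurable_compose) (use policy in \<open>simp add: policies_def\<close>)
qed simp

text \<open>\<open>step\<close> is two nested binds, which \<open>integral_bind\<close> peels off in
  turn; boundedness of \<open>g\<close> and total mass at most one justify each exchange.\<close>

lemma integral_step:
  fixes g :: "'z \<times> 'a \<Rightarrow> real"
  assumes g: "g \<in> borel_measurable N" and B: "\<And>x. x \<in> space N \<Longrightarrow> \<bar>g x\<bar> \<le> B"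
    and h: "h \<in> space (H t)"
  shows "(\<integral>x. g x \<partial>step M \<pi> z0 t h) = (\<integral>z. (\<integral>a. g (z, a) \<partial>\<pi> t (h, z)) \<partial>state_law t h)"
proof -
  have S: "sets (state_law t h) = sets (states M)" "prob_space (state_law t h)"
    using state_law_prob[OF h] by (auto simp: space_prob_algebra)
  note spS = sets_eq_imp_space_eq[OF S(1)]
  have "(\<integral>x. g x \<partial>step M \<pi> z0 t h) =
    (\<integral>z. (\<integral>x. g x \<partial>(\<pi> t (h, z) \<bind> (\<lambda>a. return N (z, a)))) \<partial>state_law t h)"
    unfolding step_def state_law_def[symmetric]
  proof (rule integral_bind[OF g B, where B'=1])
    show "(\<lambda>z. \<pi> t (h, z) \<bind> (\<lambda>a. return N (z, a))) \<in> state_law t h \<rightarrow>\<^sub>M subprob_algebra N"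
      using measurable_prob_algebraD[OF state_action_measurable[OF h]]
      by (simp add: measurable_cong_sets[OF S(1) refl])
    show "AE z in state_law t h. emeasure (\<pi> t (h, z) \<bind> (\<lambda>a. return N (z, a)))
        (space (\<pi> t (h, z) \<bind> (\<lambda>a. return N (z, a)))) \<le> ennreal 1"
      using measurable_space[OF state_action_measurable[OF h]]
      by (intro AE_I2) (simp add: spS space_prob_algebra prob_space.emeasure_space_1)
  qed (use S prob_space.finite_measure in auto)
  also have "\<dots> = (\<integral>z. (\<integral>a. g (z, a) \<partial>\<pi> t (h, z)) \<partial>state_law t h)"
  proof (rule Bochner_Integration.integral_cong[OF refl])
    fix z assume "z \<in> space (state_law t h)"
    then have z: "z \<in> space (states M)" by (simp add: spS)
    have A: "sets (\<pi> t (h, z)) = sets (actions M)" "prob_space (\<pi> t (h, z))"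
      using action_law_prob[OF h z] by (auto simp: space_prob_algebra)
    note spA = sets_eq_imp_space_eq[OF A(1)]
    have "(\<integral>x. g x \<partial>(\<pi> t (h, z) \<bind> (\<lambda>a. return N (z, a)))) = (\<integral>a. (\<integral>x. g x \<partial>return N (z, a)) \<partial>\<pi> t (h, z))"
    proof (rule integral_bind[OF g B, where B'=1])
      show "(\<lambda>a. return N (z, a)) \<in> \<pi> t (h, z) \<rightarrow>\<^sub>M subprob_algebra N"
        using z by (simp add: measurable_cong_sets[OF A(1) refl])
      show "AE a in \<pi> t (h, z). emeasure (return N (z, a)) (space (return N (z, a))) \<le> ennreal 1"
        using z by (intro AE_I2) (simp add: spA space_pair_measure)
    qed (use A prob_space.finite_measure in auto)
    also have "\<dots> = (\<integral>a. g (z, a) \<partial>\<pi> t (h, z))"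
      using z by (intro Bochner_Integration.integral_cong[OF refl] integral_return[OF _ g])
        (simp add: spA space_pair_measure)
    finally show "(\<integral>x. g x \<partial>(\<pi> t (h, z) \<bind> (\<lambda>a. return N (z, a)))) = (\<integral>a. g (z, a) \<partial>\<pi> t (h, z))" .
  qed
  finally show ?thesis .
qed


lemma integral_trajectory:
  fixes g :: "'z \<times> 'a \<Rightarrow> real"
  assumes g: "g \<in> borel_measurable N" and B: "\<And>x. x \<in> space N \<Longrightarrow> \<bar>g x\<bar> \<le> B"
  shows "(\<integral>\<omega>. g (\<omega> t) \<partial>trajectory M \<pi> z0) =
    (\<integral>h. (\<integral>z. (\<integral>a. g (z, a) \<partial>\<pi> t (h, z)) \<partial>state_law t h) \<partial>C 0 t (\<lambda>_. undefined))"
proof -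
  have "(\<integral>\<omega>. g (\<omega> t) \<partial>trajectory M \<pi> z0) = (\<integral>h. (\<integral>x. g x \<partial>step M \<pi> z0 t h) \<partial>C 0 t (\<lambda>_. undefined))"
    unfolding trajectory_eq by (rule integral_lim_component[OF g B])
  also have "\<dots> = (\<integral>h. (\<integral>z. (\<integral>a. g (z, a) \<partial>\<pi> t (h, z)) \<partial>state_law t h) \<partial>C 0 t (\<lambda>_. undefined))"
    by (intro Bochner_Integration.integral_cong refl integral_step[OF g B]) (simp_all add: space_C)
  finally show ?thesis .
qed

lemma prob_space_trajectory: "prob_space (trajectory M \<pi> z0)"
  by (simp add: trajectory_eq prob_space_lim)

lemma component_measurable: "(\<lambda>\<omega>. \<omega> t) \<in> trajectory M \<pi> z0 \<rightarrow>\<^sub>M N"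
  by (simp add: trajectory_eq measurable_cong_sets[OF PF.sets_lim refl])

lemma integrable_trajectory:
  fixes g :: "'z \<times> 'a \<Rightarrow> real"
  assumes g: "g \<in> borel_measurable N" and B: "\<And>x. x \<in> space N \<Longrightarrow> \<bar>g x\<bar> \<le> B"
  shows "integrable (trajectory M \<pi> z0) (\<lambda>\<omega>. g (\<omega> t))"
proof -
  interpret prob_space "trajectory M \<pi> z0" by (rule prob_space_trajectory)
  show ?thesis
    using B measurable_space[OF component_measurable]
    by (intro integrable_const_bound[where B=B] AE_I2 measurable_compose[OF component_measurable g]) auto
qed

text \<open>An integrand that ignores the action is constant under the action law, which has mass
  one, so only the state law survives.\<close>

lemma integral_state_trajectory:
  fixes u :: "'z \<Rightarrow> real"
  assumes u: "u \<in> borel_measurable (states M)" and U: "\<And>z. z \<in> space (states M) \<Longrightarrow> \<bar>u z\<bar> \<le> U"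
  shows "(\<integral>\<omega>. u (fst (\<omega> t)) \<partial>trajectory M \<pi> z0) =
    (\<integral>h. (\<integral>z. u z \<partial>state_law t h) \<partial>C 0 t (\<lambda>_. undefined))"
proof -
  have "(\<integral>\<omega>. u (fst (\<omega> t)) \<partial>trajectory M \<pi> z0) =
    (\<integral>h. (\<integral>z. (\<integral>a. u z \<partial>\<pi> t (h, z)) \<partial>state_law t h) \<partial>C 0 t (\<lambda>_. undefined))"
    using integral_trajectory[OF measurable_compose[OF measurable_fst u], of U] U
    by (auto simp: space_pair_measure)
  also have "\<dots> = (\<integral>h. (\<integral>z. u z \<partial>state_law t h) \<partial>C 0 t (\<lambda>_. undefined))"
  proof (intro Bochner_Integration.integral_cong refl)
    fix h z assume "h \<in> space (C 0 t (\<lambda>_. undefined))" and z: "z \<in> space (state_law t h)"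
    then have h: "h \<in> space (H t)" by (simp add: space_C)
    have "z \<in> space (states M)"
      using z state_law_prob[OF h] by (auto simp: space_prob_algebra dest: sets_eq_imp_space_eq)
    then interpret prob_space "\<pi> t (h, z)"
      using action_law_prob[OF h] by (simp add: space_prob_algebra)
    show "(\<integral>a. u z \<partial>\<pi> t (h, z)) = u z" by (simp add: prob_space)
  qed
  finally show ?thesis .
qed

lemma integral_state_0:
  fixes u :: "'z \<Rightarrow> real"
  assumes u: "u \<in> borel_measurable (states M)" and U: "\<And>z. z \<in> space (states M) \<Longrightarrow> \<bar>u z\<bar> \<le> U"
  shows "(\<integral>\<omega>. u (fst (\<omega> 0)) \<partial>trajectory M \<pi> z0) = u z0"
proof -
  interpret C: prob_space "C 0 0 (\<lambda>_. undefined)" by (rule prob_space_C) simp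
  show ?thesis
    by (subst integral_state_trajectory[OF u U])
      (simp_all add: state_law_def integral_return[OF initial u] C.prob_space del: C.simps)
qed

lemma transition_integral_measurable:
  fixes u :: "'z \<Rightarrow> real"
  assumes "u \<in> borel_measurable (states M)"
  shows "(\<lambda>x. \<integral>y. u y \<partial>transition M x) \<in> borel_measurable N"
  using measurable_compose[OF measurable_prob_algebraD[OF transition_measurable]
      integral_measurable_subprob_algebra[OF assms]] .

lemma transition_integral_bounded:
  fixes u :: "'z \<Rightarrow> real"
  assumes u: "u \<in> borel_measurable (states M)" and U: "\<And>z. z \<in> space (states M) \<Longrightarrow> \<bar>u z\<bar> \<le> U"
    and x: "x \<in> space N"
  shows "\<bar>\<integral>y. u y \<partial>transition M x\<bar> \<le> U"
proof -
  have T: "prob_space (transition M x)" "space (transition M x) = space (states M)"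
    "sets (transition M x) = sets (states M)"
    using measurable_space[OF transition_measurable x]
    by (auto simp: space_prob_algebra dest: sets_eq_imp_space_eq)
  interpret prob_space "transition M x" by fact
  have "AE y in transition M x. \<bar>u y - 0\<bar> \<le> U"
    using U T by (intro AE_I2) simp
  from abs_expectation_diff_le[OF _ this] u show ?thesis
    by (simp add: measurable_cong_sets[OF T(3) refl])
qed

text \<open>The Markov property in mean: given the history, the next state has law
  \<open>transition M (h t)\<close> under every policy.\<close>

lemma integral_state_Suc:
  fixes u :: "'z \<Rightarrow> real"
  assumes u: "u \<in> borel_measurable (states M)" and U: "\<And>z. z \<in> space (states M) \<Longrightarrow> \<bar>u z\<bar> \<le> U"
  shows "(\<integral>\<omega>. u (fst (\<omega> (Suc t))) \<partial>trajectory M \<pi> z0) =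
    (\<integral>\<omega>. (\<integral>y. u y \<partial>transition M (\<omega> t)) \<partial>trajectory M \<pi> z0)"
  by (subst integral_state_trajectory[OF u U])
    (simp_all add: state_law_def trajectory_eq integral_C_component[OF transition_integral_measurable[OF u]]
      del: C.simps)

text \<open>The geometric series \<open>B * \<beta> ^ t\<close> dominates the discounted costs,
  which licenses exchanging sum and integral.\<close>

lemma discounted_cost_sums:
  assumes \<beta>: "0 < \<beta>" "\<beta> < 1" and B: "\<And>x. x \<in> space N \<Longrightarrow> \<bar>cost M x\<bar> \<le> B"
  shows "(\<lambda>t. \<beta> ^ t * (\<integral>\<omega>. cost M (\<omega> t) \<partial>trajectory M \<pi> z0)) sums discounted_cost M \<beta> \<pi> z0"
proof -
  let ?T = "trajectory M \<pi> z0"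
  interpret prob_space ?T by (rule prob_space_trajectory)
  note int = integrable_trajectory[OF cost_measurable B]
  have sp: "\<omega> \<in> space ?T \<Longrightarrow> \<omega> t \<in> space N" for \<omega> t
    using measurable_space[OF component_measurable] .
  have bd: "norm (\<beta> ^ t * cost M (\<omega> t)) \<le> B * \<beta> ^ t" if "\<omega> \<in> space ?T" for \<omega> t
    using B[OF sp[OF that, of t]] \<beta> by (simp add: abs_mult mult.commute mult_right_mono)
  have geo: "summable (\<lambda>t. B * \<beta> ^ t)" using \<beta> by (simp add: summable_mult summable_geometric)
  have 1: "AE \<omega> in ?T. summable (\<lambda>t. norm (\<beta> ^ t * cost M (\<omega> t)))"
    using bd by (intro AE_I2 summable_comparison_test'[OF geo, of 0]) auto
  have "(\<integral>\<omega>. norm (\<beta> ^ t * cost M (\<omega> t)) \<partial>?T) \<le> (\<integral>\<omega>. B * \<beta> ^ t \<partial>?T)" for t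
    using bd by (intro integral_mono integrable_norm integrable_mult_right int) auto
  then have 2: "summable (\<lambda>t. \<integral>\<omega>. norm (\<beta> ^ t * cost M (\<omega> t)) \<partial>?T)"
    by (intro summable_comparison_test'[OF geo, of 0]) (simp add: prob_space)
  have I: "integrable ?T (\<lambda>\<omega>. \<beta> ^ t * cost M (\<omega> t))" for t
    by (intro integrable_mult_right int)
  show ?thesis
    using summable_sums[OF summable_integral[OF I 1 2]] integral_suminf[OF I 1 2]
    by (simp add: discounted_cost_def)
qed

text \<open>With \<open>e t\<close> the mean of \<open>u\<close> at time \<open>t\<close>, the mean
  residual is the mean cost plus \<open>\<beta> * e (Suc t) - e t\<close>. After discounting, the
  \<open>e\<close> terms telescope to \<open>- u z0\<close>, since \<open>e\<close> is bounded and
  \<open>e 0 = u z0\<close>.\<close>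

lemma bellman_residual_sums:
  fixes u :: "'z \<Rightarrow> real"
  assumes \<beta>: "0 < \<beta>" "\<beta> < 1" and B: "\<And>x. x \<in> space N \<Longrightarrow> \<bar>cost M x\<bar> \<le> B"
    and u: "u \<in> borel_measurable (states M)" and U: "\<And>z. z \<in> space (states M) \<Longrightarrow> \<bar>u z\<bar> \<le> U"
  shows "(\<lambda>t. \<beta> ^ t * (\<integral>\<omega>. bellman_residual M \<beta> u (\<omega> t) \<partial>trajectory M \<pi> z0)) sums (discounted_cost M \<beta> \<pi> z0 - u z0)"
proof -
  let ?T = "trajectory M \<pi> z0"
  interpret prob_space ?T by (rule prob_space_trajectory)
  define e where "e t = (\<integral>\<omega>. u (fst (\<omega> t)) \<partial>?T)" for t
  have uf: "(\<lambda>x. u (fst x)) \<in> borel_measurable N" using u by simp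
  have Uf: "x \<in> space N \<Longrightarrow> \<bar>u (fst x)\<bar> \<le> U" for x using U by (auto simp: space_pair_measure)
  have ED: "(\<integral>\<omega>. bellman_residual M \<beta> u (\<omega> t) \<partial>?T) = (\<integral>\<omega>. cost M (\<omega> t) \<partial>?T) + \<beta> * e (Suc t) - e t" for t
    unfolding bellman_residual_def e_def integral_state_Suc[OF u U, of t, simplified]
    using integrable_trajectory[OF cost_measurable B] integrable_trajectory[OF uf Uf]
      integrable_trajectory[OF transition_integral_measurable[OF u] transition_integral_bounded[OF u U]]
    by (subst Bochner_Integration.integral_diff Bochner_Integration.integral_add; simp)+
  have "\<bar>e t\<bar> \<le> U" for t
    unfolding e_def
    using abs_expectation_diff_le[OF measurable_compose[OF component_measurable uf, of t], of 0 U]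
      Uf measurable_space[OF component_measurable, of _ t] by simp
  then have "(\<lambda>t. \<beta> ^ t * e t) \<longlonglongrightarrow> 0"
    using \<beta> by (intro lim_null_mult_right_bounded[where B=U] LIMSEQ_realpow_zero) auto
  from telescope_sums'[OF this]
  have "(\<lambda>t. \<beta> ^ t * e t - \<beta> ^ Suc t * e (Suc t)) sums u z0"
    by (simp add: e_def integral_state_0[OF u U])
  from sums_diff[OF discounted_cost_sums[OF \<beta> B] this]
  show ?thesis by (simp add: ED algebra_simps)
qed


lemma bellman_residual_measurable:
  assumes "u \<in> borel_measurable (states M)"
  shows "bellman_residual M \<beta> u \<in> borel_measurable N"
proof -
  have "(\<lambda>x. cost M x + \<beta> * (\<integral>y. u y \<partial>transition M x) - u (fst x)) \<in> borel_measurable N"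
    using transition_integral_measurable[OF assms] cost_measurable measurable_compose[OF measurable_fst assms]
    by (intro borel_measurable_diff borel_measurable_add borel_measurable_times) simp_all
  then show ?thesis by (simp add: bellman_residual_def[abs_def])
qed

lemma bellman_residual_bounded:
  fixes u :: "'z \<Rightarrow> real"
  assumes "0 < \<beta>" "\<beta> < 1" and B: "\<And>x. x \<in> space N \<Longrightarrow> \<bar>cost M x\<bar> \<le> B"
    and u: "u \<in> borel_measurable (states M)" and U: "\<And>z. z \<in> space (states M) \<Longrightarrow> \<bar>u z\<bar> \<le> U"
    and x: "x \<in> space N"
  shows "\<bar>bellman_residual M \<beta> u x\<bar> \<le> B + \<beta> * U + U"
proof -
  have "\<bar>u (fst x)\<bar> \<le> U" using x U by (auto simp: space_pair_measure)
  moreover have "\<bar>\<beta> * (\<integral>y. u y \<partial>transition M x)\<bar> \<le> \<beta> * U"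
    using transition_integral_bounded[OF u U x] assms(1) by (simp add: abs_mult)
  ultimately show ?thesis using B[OF x] unfolding bellman_residual_def by linarith
qed

text \<open>Each discounted residual is at least \<open>- \<epsilon> * \<beta> ^ t\<close>; these
  bounds form a geometric series. Used with \<open>\<epsilon> = 0\<close> in the original model and
  with a small error in the finite one.\<close>

lemma discounted_cost_ge:
  fixes u :: "'z \<Rightarrow> real"
  assumes \<beta>: "0 < \<beta>" "\<beta> < 1" and B: "\<And>x. x \<in> space N \<Longrightarrow> \<bar>cost M x\<bar> \<le> B"
    and u: "u \<in> borel_measurable (states M)" and U: "\<And>z. z \<in> space (states M) \<Longrightarrow> \<bar>u z\<bar> \<le> U"
    and res: "\<And>x. x \<in> space N \<Longrightarrow> - \<epsilon> \<le> bellman_residual M \<beta> u x"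
  shows "u z0 - \<epsilon> / (1 - \<beta>) \<le> discounted_cost M \<beta> \<pi> z0"
proof -
  interpret prob_space "trajectory M \<pi> z0" by (rule prob_space_trajectory)
  have "- \<epsilon> \<le> (\<integral>\<omega>. bellman_residual M \<beta> u (\<omega> t) \<partial>trajectory M \<pi> z0)" for t
    using res measurable_space[OF component_measurable]
    by (intro integral_ge_const AE_I2 integrable_trajectory[OF bellman_residual_measurable[OF u]
          bellman_residual_bounded[OF \<beta> B u U]]) auto
  then have "\<beta> ^ t * - \<epsilon> \<le> \<beta> ^ t * (\<integral>\<omega>. bellman_residual M \<beta> u (\<omega> t) \<partial>trajectory M \<pi> z0)" for t
    using \<beta> by (intro mult_left_mono) auto
  from sums_le[OF this sums_mult2[OF geometric_sums] bellman_residual_sums[OF \<beta> B u U]] \<beta>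
  show ?thesis by simp
qed

end

section \<open>Processes under a deterministic stationary policy\<close>

locale stationary_process =
  fixes M :: "('z, 'a) mdp" and f :: "'z \<Rightarrow> 'a" and z0 :: 'z
  assumes mdp: "is_mdp M" and selector: "f \<in> states M \<rightarrow>\<^sub>M actions M" and initial: "z0 \<in> space (states M)"
begin

sublocale controlled_process M "stationary M f" z0
  using mdp initial stationary_policy[OF selector] by unfold_locales

text \<open>The action law is a point mass at \<open>f z\<close>. Phrasing this through means avoids
  almost sure statements about the graph of \<open>f\<close>, which need not be a measurable
  set.\<close>

lemma integral_trajectory_stationary:
  fixes g :: "'z \<times> 'a \<Rightarrow> real"
  assumes g: "g \<in> borel_measurable N" and B: "\<And>x. x \<in> space N \<Longrightarrow> \<bar>g x\<bar> \<le> B"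
  shows "(\<integral>\<omega>. g (\<omega> t) \<partial>trajectory M (stationary M f) z0) =
    (\<integral>\<omega>. g (fst (\<omega> t), f (fst (\<omega> t))) \<partial>trajectory M (stationary M f) z0)"
proof -
  have m: "(\<lambda>z. g (z, f z)) \<in> borel_measurable (states M)"
    by (rule measurable_compose[OF _ g]) (use selector in simp)
  have b: "\<bar>g (z, f z)\<bar> \<le> B" if "z \<in> space (states M)" for z
    using B[of "(z, f z)"] that measurable_space[OF selector that] by (simp add: space_pair_measure)
  have act: "(\<integral>a. g (z, a) \<partial>stationary M f t (h, z)) = g (z, f z)"
    if "h \<in> space (H t)" "z \<in> space (state_law t h)" for h z
  proof -
    have z: "z \<in> space (states M)"
      using that state_law_prob by (auto simp: space_prob_algebra dest: sets_eq_imp_space_eq)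
    have "(\<lambda>a. g (z, a)) \<in> borel_measurable (actions M)"
      by (rule measurable_compose[OF _ g]) (use z in simp)
    with measurable_space[OF selector z] show ?thesis
      by (simp add: stationary_def integral_return)
  qed
  have "(\<integral>\<omega>. g (\<omega> t) \<partial>trajectory M (stationary M f) z0) =
    (\<integral>h. (\<integral>z. (\<integral>a. g (z, a) \<partial>stationary M f t (h, z)) \<partial>state_law t h) \<partial>C 0 t (\<lambda>_. undefined))"
    by (rule integral_trajectory[OF g B])
  also have "\<dots> = (\<integral>h. (\<integral>z. g (z, f z) \<partial>state_law t h) \<partial>C 0 t (\<lambda>_. undefined))"
    by (intro Bochner_Integration.integral_cong refl act) (simp_all add: space_C)
  also have "\<dots> = (\<integral>\<omega>. g (fst (\<omega> t), f (fst (\<omega> t))) \<partial>trajectory M (stationary M f) z0)"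
    by (rule integral_state_trajectory[OF m b, symmetric])
  finally show ?thesis .
qed

text \<open>In mean the trajectory meets only pairs \<open>(z, f z)\<close>, so a residual bound
  there is enough; summing it against \<open>\<beta> ^ t\<close> gives the estimate.\<close>

lemma stationary_cost_le:
  fixes u :: "'z \<Rightarrow> real"
  assumes \<beta>: "0 < \<beta>" "\<beta> < 1" and B: "\<And>x. x \<in> space N \<Longrightarrow> \<bar>cost M x\<bar> \<le> B"
    and u: "u \<in> borel_measurable (states M)" and U: "\<And>z. z \<in> space (states M) \<Longrightarrow> \<bar>u z\<bar> \<le> U"
    and res: "\<And>z. z \<in> space (states M) \<Longrightarrow> bellman_residual M \<beta> u (z, f z) \<le> \<epsilon>"
  shows "discounted_cost M \<beta> (stationary M f) z0 \<le> u z0 + \<epsilon> / (1 - \<beta>)"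
proof -
  let ?T = "trajectory M (stationary M f) z0"
  interpret prob_space ?T by (rule prob_space_trajectory)
  note g = bellman_residual_measurable[OF u] bellman_residual_bounded[OF \<beta> B u U]
  have sp: "fst (\<omega> t) \<in> space (states M)" if "\<omega> \<in> space ?T" for \<omega> t
    using measurable_space[OF component_measurable that, of t] by (auto simp: space_pair_measure)
  have sp2: "(fst (\<omega> t), f (fst (\<omega> t))) \<in> space N" if "\<omega> \<in> space ?T" for \<omega> t
    using sp[OF that] measurable_space[OF selector] by (auto simp: space_pair_measure)
  have "(\<lambda>\<omega>. fst (\<omega> t)) \<in> ?T \<rightarrow>\<^sub>M states M" for t
    by (rule measurable_compose[OF component_measurable measurable_fst])
  then have "(\<lambda>\<omega>. (fst (\<omega> t), f (fst (\<omega> t)))) \<in> ?T \<rightarrow>\<^sub>M N" for t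
    using measurable_compose[OF _ selector] by (intro measurable_Pair) blast+
  then have "(\<integral>\<omega>. bellman_residual M \<beta> u (fst (\<omega> t), f (fst (\<omega> t))) \<partial>?T) \<le> \<epsilon>" for t
    using res sp g(2) sp2
    by (intro integral_le_const AE_I2 integrable_const_bound[where B="B + \<beta> * U + U"]
        measurable_compose[OF _ g(1)]) auto
  then have "(\<integral>\<omega>. bellman_residual M \<beta> u (\<omega> t) \<partial>?T) \<le> \<epsilon>" for t
    by (subst integral_trajectory_stationary[OF g])
  then have "\<beta> ^ t * (\<integral>\<omega>. bellman_residual M \<beta> u (\<omega> t) \<partial>?T) \<le> \<beta> ^ t * \<epsilon>" for t
    using \<beta> by (intro mult_left_mono) auto
  from sums_le[OF this bellman_residual_sums[OF \<beta> B u U] sums_mult2[OF geometric_sums]] \<beta>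
  show ?thesis by simp
qed

text \<open>A converse to \<open>stationary_cost_le\<close>: the discounted residuals sum to the gap
  between cost and \<open>u\<close>. As none is far below zero, the time-0 term, the residual at
  \<open>z0\<close>, cannot exceed the gap by much. Any state may serve as
  \<open>z0\<close>.\<close>

lemma stationary_residual_le:
  fixes u :: "'z \<Rightarrow> real"
  assumes \<beta>: "0 < \<beta>" "\<beta> < 1" and B: "\<And>x. x \<in> space N \<Longrightarrow> \<bar>cost M x\<bar> \<le> B"
    and u: "u \<in> borel_measurable (states M)" and U: "\<And>z. z \<in> space (states M) \<Longrightarrow> \<bar>u z\<bar> \<le> U"
    and \<epsilon>: "0 \<le> \<epsilon>" and res: "\<And>x. x \<in> space N \<Longrightarrow> - \<epsilon> \<le> bellman_residual M \<beta> u x"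
  shows "bellman_residual M \<beta> u (z0, f z0) \<le>
    discounted_cost M \<beta> (stationary M f) z0 - u z0 + \<epsilon> / (1 - \<beta>)"
proof -
  let ?T = "trajectory M (stationary M f) z0" and ?r = "bellman_residual M \<beta> u"
  interpret prob_space ?T by (rule prob_space_trajectory)
  note g = bellman_residual_measurable[OF u] bellman_residual_bounded[OF \<beta> B u U]
  have m: "(\<lambda>z. ?r (z, f z)) \<in> borel_measurable (states M)"
    by (rule measurable_compose[OF _ g(1)]) (use selector in simp)
  have b: "\<bar>?r (z, f z)\<bar> \<le> B + \<beta> * U + U" if "z \<in> space (states M)" for z
    using g(2)[of "(z, f z)"] that measurable_space[OF selector that] by (simp add: space_pair_measure)
  have r0: "(\<integral>\<omega>. ?r (\<omega> 0) \<partial>?T) = ?r (z0, f z0)"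
    by (rule trans[OF integral_trajectory_stationary[OF g] integral_state_0[OF m b]])
  have r: "- \<epsilon> \<le> (\<integral>\<omega>. ?r (\<omega> t) \<partial>?T)" for t
    using res measurable_space[OF component_measurable]
    by (intro integral_ge_const AE_I2 integrable_trajectory[OF g]) auto
  \<comment> \<open>This minorant keeps the exact term at time 0 and replaces all later ones by
    their lower bound.\<close>
  have le: "\<beta> ^ t * - \<epsilon> + (if t = 0 then ?r (z0, f z0) + \<epsilon> else 0) \<le> \<beta> ^ t * (\<integral>\<omega>. ?r (\<omega> t) \<partial>?T)" for t
    using mult_left_mono[OF r[of t], of "\<beta> ^ t"] \<beta> r0 by (cases "t = 0") auto
  \<comment> \<open>The surplus \<open>+ \<epsilon>\<close> arises because the worst case is not
    charged at time 0; it is dropped by \<open>0 \<le> \<epsilon>\<close>.\<close>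
  have "(\<lambda>t. \<beta> ^ t * - \<epsilon> + (if t = 0 then ?r (z0, f z0) + \<epsilon> else 0)) sums
      (1 / (1 - \<beta>) * - \<epsilon> + (?r (z0, f z0) + \<epsilon>))"
    using \<beta> sums_single[of 0 "\<lambda>_. ?r (z0, f z0) + \<epsilon>"]
    by (intro sums_add sums_mult2 geometric_sums) auto
  from sums_le[OF le this bellman_residual_sums[OF \<beta> B u U]] \<epsilon>
  show ?thesis by simp
qed

end


section \<open>The Bellman equation of a weakly continuous model\<close>

text \<open>Weak continuity is tested along sequences, which decide continuity on a metric
  domain.\<close>

lemma continuous_on_kernel_integral:
  fixes p :: "'x::metric_space \<Rightarrow> 'z::topological_space measure" and u :: "'z \<Rightarrow> real"
  assumes "weakly_continuous_kernel p" "continuous_on UNIV u" "bounded (range u)"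
  shows "continuous_on UNIV (\<lambda>x. \<integral>y. u y \<partial>p x)"
  using assms by (auto simp: continuous_on_sequentially comp_def weakly_continuous_kernel_def weakly_converges_def)

text \<open>Uniform continuity on the product gives one distance bound for all actions. Evaluating
  \<open>G\<close> at the other point's minimiser then compares the two minima, however irregularly
  \<open>s\<close> picks minimisers.\<close>

lemma continuous_on_minimum:
  fixes G :: "'z::metric_space \<times> 'a::metric_space \<Rightarrow> real"
  assumes compact: "compact (UNIV :: 'z set)" "compact (UNIV :: 'a set)"
    and G: "continuous_on UNIV G" and min: "\<And>z a. G (z, s z) \<le> G (z, a)"
  shows "continuous_on UNIV (\<lambda>z. G (z, s z))"
proof -
  have "uniformly_continuous_on UNIV G"
    using compact_uniformly_continuous[OF G] compact_Times[OF compact] by simp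
  then have unif: "\<exists>d>0. \<forall>x y. dist x y < d \<longrightarrow> dist (G x) (G y) < e" if "e > 0" for e
    using that by (auto simp: uniformly_continuous_on_def dist_commute)
  show ?thesis
    unfolding continuous_on_iff
  proof (intro ballI allI impI)
    fix z and e :: real assume "0 < e"
    from unif[OF this] obtain d where d: "d > 0" "\<And>x y. dist x y < d \<Longrightarrow> dist (G x) (G y) < e" by blast
    have "dist (G (z', s z')) (G (z, s z)) < e" if "dist z' z < d" for z'
    proof -
      have "dist (G (z', a)) (G (z, a)) < e" for a
        using d(2)[of "(z', a)" "(z, a)"] that by (simp add: dist_Pair_Pair)
      from this[of "s z"] this[of "s z'"] min[of z "s z'"] min[of z' "s z"] show ?thesis
        unfolding dist_real_def by linarith
    qed
    with d(1) show "\<exists>d>0. \<forall>z'\<in>UNIV. dist z' z < d \<longrightarrow> dist (G (z', s z')) (G (z, s z)) < e" by blast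
  qed
qed

text \<open>Banach's fixed point theorem on the bounded continuous functions. The minimiser
  \<open>s\<close> is a pointwise choice; it later acts as a policy only on finite state sets, where
  every map is measurable.\<close>

lemma Bellman_equation_solution:
  fixes M :: "('z::polish_space, 'a::polish_space) mdp"
  assumes mdp: "is_mdp M" "states M = borel" "actions M = borel"
    and compact: "compact (UNIV :: 'z set)" "compact (UNIV :: 'a set)"
    and cost: "continuous_on UNIV (cost M)"
    and kernel: "weakly_continuous_kernel (transition M)"
    and \<beta>: "0 < \<beta>" "\<beta> < 1"
  obtains v s where "continuous_on UNIV v"
    "\<And>z a. 0 \<le> bellman_residual M \<beta> v (z, a)" "\<And>z. bellman_residual M \<beta> v (z, s z) = 0"
proof -
  define G :: "('z \<Rightarrow>\<^sub>C real) \<Rightarrow> 'z \<times> 'a \<Rightarrow> real"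
    where "G u x = cost M x + \<beta> * (\<integral>y. u y \<partial>transition M x)" for u x
  have G: "continuous_on UNIV (G u)" for u
    unfolding G_def
    by (intro continuous_intros cost continuous_on_kernel_integral kernel) auto
  have "\<exists>b. \<forall>a. G u (z, b) \<le> G u (z, a)" for u z
  proof -
    have "continuous_on UNIV (\<lambda>a. G u (z, a))"
      by (rule continuous_on_compose2[OF G]) (auto intro!: continuous_intros)
    from continuous_attains_inf[OF compact(2) _ this] show ?thesis by auto
  qed
  then obtain s where s: "\<And>u z a. G u (z, s u z) \<le> G u (z, a)" by metis
  \<comment> \<open>\<open>Bcontfun\<close> is meaningful only on bounded continuous functions; the
    next fact supplies this from compactness.\<close>
  define T where "T u = Bcontfun (\<lambda>z. G u (z, s u z))" for u
  have T: "apply_bcontfun (T u) = (\<lambda>z. G u (z, s u z))" for u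
  proof -
    have c: "continuous_on UNIV (\<lambda>z. G u (z, s u z))"
      using compact G s by (rule continuous_on_minimum)
    have "bounded (range (\<lambda>z. G u (z, s u z)))"
      by (rule compact_imp_bounded[OF compact_continuous_image[OF c compact(1)]])
    with c show ?thesis by (simp add: T_def Bcontfun_inverse bcontfun_def)
  qed
  have diff: "\<bar>G u x - G w x\<bar> \<le> \<beta> * dist u w" for u w x
  proof -
    have tr: "prob_space (transition M x)" "sets (transition M x) = sets borel"
      using mdp measurable_space[of "transition M" "borel \<Otimes>\<^sub>M borel" "prob_algebra borel" x]
      by (auto simp: is_mdp_def space_prob_algebra space_pair_measure)
    interpret prob_space "transition M x" by fact
    have meas: "apply_bcontfun u \<in> borel_measurable (transition M x)" for u :: "'z \<Rightarrow>\<^sub>C real"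
      by (simp add: measurable_cong_sets[OF tr(2) refl] borel_measurable_continuous_onI)
    have int: "integrable (transition M x) (apply_bcontfun u)" for u :: "'z \<Rightarrow>\<^sub>C real"
      using norm_bounded[of u] by (intro integrable_const_bound[where B="norm u"] AE_I2 meas) simp
    have "AE y in transition M x. \<bar>(u y - w y) - 0\<bar> \<le> dist u w"
      using dist_bounded[of u _ w] by (intro AE_I2) (simp add: dist_real_def)
    from abs_expectation_diff_le[OF _ this] meas
    have "\<bar>expectation u - expectation w\<bar> \<le> dist u w"
      by (simp add: Bochner_Integration.integral_diff int)
    moreover have "G u x - G w x = \<beta> * (expectation u - expectation w)"
      by (simp add: G_def algebra_simps)
    ultimately show ?thesis using \<beta> by (simp add: abs_mult)
  qed
  \<comment> \<open>Minima are compared by evaluating each at the other's minimiser, so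
    \<open>T\<close> inherits the Lipschitz constant \<open>\<beta>\<close> from
    \<open>G\<close>.\<close>
  have "dist (T u) (T w) \<le> \<beta> * dist u w" for u w
  proof (rule dist_bound)
    fix z
    show "dist (T u z) (T w z) \<le> \<beta> * dist u w"
      using diff[of u "(z, s w z)" w] diff[of u "(z, s u z)" w] s[of u z "s w z"] s[of w z "s u z"]
      unfolding T dist_real_def by linarith
  qed
  with banach_fix_type[of \<beta> T] \<beta> obtain v where v: "T v = v" by auto
  \<comment> \<open>At the fixed point the residual is the excess of \<open>G v (z, a)\<close> over
    its minimum in \<open>a\<close>.\<close>
  have "bellman_residual M \<beta> v (z, a) = G v (z, a) - G v (z, s v z)" for z a
    using fun_cong[OF T[of v], of z] by (simp add: bellman_residual_def G_def v)
  with s that[of v "s v"] show ?thesis by auto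
qed

section \<open>Finite models\<close>

text \<open>Conditioning on \<open>A\<close> leaves no mass outside \<open>A\<close>, so the
  indicator in the set integral is 1 almost everywhere.\<close>

lemma integral_uniform_measure_cell:
  fixes g :: "'b \<Rightarrow> real"
  assumes "A \<in> sets \<nu>" "g \<in> borel_measurable \<nu>"
  shows "(LINT z:A|uniform_measure \<nu> A. g z) = (\<integral>z. g z \<partial>uniform_measure \<nu> A)"
  unfolding set_lebesgue_integral_def
  using assms by (intro integral_cong_AE AE_uniform_measureI) (auto simp: measurable_cong_sets[OF sets_uniform_measure refl])

text \<open>Lets the transition sums of the finite model be read as integrals of
  \<open>v \<circ> Q\<close> against the original kernel.\<close>

lemma integral_finite_range:
  fixes v :: "'b \<Rightarrow> real"
  assumes "finite_measure P" "finite Y" and Q: "Q \<in> P \<rightarrow>\<^sub>M count_space Y"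
  shows "(\<integral>x. v (Q x) \<partial>P) = (\<Sum>y\<in>Y. v y * measure P (Q -` {y} \<inter> space P))"
proof -
  interpret finite_measure P by fact
  have "(\<integral>x. v (Q x) \<partial>P) = (\<integral>x. (\<Sum>y\<in>Y. v y * indicator (Q -` {y} \<inter> space P) x) \<partial>P)"
  proof (rule Bochner_Integration.integral_cong[OF refl])
    fix x assume x: "x \<in> space P"
    with measurable_space[OF Q x] \<open>finite Y\<close> show "v (Q x) = (\<Sum>y\<in>Y. v y * indicator (Q -` {y} \<inter> space P) x)"
      by (simp add: indicator_def if_distrib[of "\<lambda>c. _ * c"] sum.If_cases cong: if_cong)
  qed
  also have "\<dots> = (\<Sum>y\<in>Y. v y * measure P (Q -` {y} \<inter> space P))"
    using measurable_sets[OF Q, of "{_}"]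
    by (subst Bochner_Integration.integral_sum) (auto simp: emeasure_eq_measure intro!: integrable_mult_right integrable_real_indicator)
  finally show ?thesis .
qed

section \<open>One finite model against the original\<close>

locale quantized_mdp =
  fixes M :: "('z::polish_space, 'a::polish_space) mdp" and Y :: "'z set" and Q :: "'z \<Rightarrow> 'z" and \<nu> :: "'z measure"
  assumes M: "is_mdp M" "states M = borel" "actions M = borel" "bounded (range (cost M))"
    and Y: "finite Y" and Q: "Q \<in> borel \<rightarrow>\<^sub>M count_space Y"
    and nu: "prob_space \<nu>" "sets \<nu> = sets borel" "\<And>y. y \<in> Y \<Longrightarrow> measure \<nu> (Q -` {y}) > 0"
begin

abbreviation M' where "M' \<equiv> finite_model M Y Q \<nu>"
abbreviation U where "U y \<equiv> uniform_measure \<nu> (Q -` {y})"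

lemma is_mdp_finite_model: "is_mdp M'"
  using finite_model_is_mdp[OF M(1-3) Y Q nu] .

lemma Q_in: "Q z \<in> Y"
  using measurable_space[OF Q, of z] by simp

lemma transition_prob: "prob_space (transition M x)" "sets (transition M x) = sets borel"
  using M measurable_space[of "transition M" "borel \<Otimes>\<^sub>M borel" "prob_algebra borel" x]
  by (auto simp: is_mdp_def space_prob_algebra space_pair_measure)

lemma cell_measurable: "y \<in> Y \<Longrightarrow> Q -` {y} \<in> sets borel"
  using measurable_sets[OF Q, of "{y}"] by simp

lemma prob_space_cell: "y \<in> Y \<Longrightarrow> prob_space (U y)"
  using nu(3)[of y] prob_space.finite_measure[OF nu(1)]
  by (intro prob_space_uniform_measure) (auto simp: finite_measure.emeasure_eq_measure)

lemma AE_cell: "y \<in> Y \<Longrightarrow> (\<And>z. Q z = y \<Longrightarrow> P z) \<Longrightarrow> AE z in U y. P z"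
  using cell_measurable[of y] nu(2) by (intro AE_uniform_measureI) auto

lemma section_measurable:
  fixes g :: "'z \<times> 'a \<Rightarrow> real"
  assumes "g \<in> borel_measurable (borel \<Otimes>\<^sub>M borel)"
  shows "(\<lambda>z. g (z, a)) \<in> borel_measurable borel"
  by (rule measurable_compose[OF _ assms]) simp

text \<open>Averaging a cost over a cell preserves its bound, so one constant serves both
  models.\<close>

lemma cost_bound:
  obtains B where "\<And>x. \<bar>cost M x\<bar> \<le> B" "\<And>x. x \<in> space (states M' \<Otimes>\<^sub>M actions M') \<Longrightarrow> \<bar>cost M' x\<bar> \<le> B"
proof -
  from M(4) obtain B where B: "\<And>x. \<bar>cost M x\<bar> \<le> B" by (auto simp: bounded_iff)
  have c: "cost M \<in> borel_measurable (borel \<Otimes>\<^sub>M borel)" using M by (simp add: is_mdp_def)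
  have "\<bar>cost M' (y, a)\<bar> \<le> B" if y: "y \<in> Y" for y a
  proof -
    interpret prob_space "U y" using y by (rule prob_space_cell)
    have m: "(\<lambda>z. cost M (z, a)) \<in> borel_measurable (U y)"
      using section_measurable[OF c] by (simp add: measurable_cong_sets[OF sets_uniform_measure refl] measurable_cong_sets[OF nu(2) refl])
    have "AE z in U y. \<bar>cost M (z, a) - 0\<bar> \<le> B" using B by simp
    from abs_expectation_diff_le[OF m this] show ?thesis
      using y section_measurable[OF c] cell_measurable nu(2)
      by (simp add: finite_model_def integral_uniform_measure_cell measurable_cong_sets[OF nu(2) refl])
  qed
  with B that[of B] show ?thesis by (auto simp: finite_model_def space_pair_measure)
qed

text \<open>The finite residual at \<open>(y, a)\<close> is a cell average of one-step values minus
  \<open>v y\<close>. Quantizing the next state costs \<open>\<beta> * e\<close>, moving from a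
  point of the cell to \<open>y\<close> costs \<open>e\<close>, and \<open>v y\<close> is common to
  both residuals.\<close>

lemma finite_model_residual:
  fixes v :: "'z \<Rightarrow> real"
  assumes \<beta>: "0 < \<beta>" and v: "v \<in> borel_measurable borel" "bounded (range v)"
    and e: "\<And>z. \<bar>v z - v (Q z)\<bar> \<le> e"
      "\<And>z a. \<bar>(cost M (z, a) + \<beta> * (\<integral>y. v y \<partial>transition M (z, a)))
        - (cost M (Q z, a) + \<beta> * (\<integral>y. v y \<partial>transition M (Q z, a)))\<bar> \<le> e"
    and y: "y \<in> Y"
  shows "\<bar>bellman_residual M' \<beta> v (y, a) - bellman_residual M \<beta> v (y, a)\<bar> \<le> (1 + \<beta>) * e"
proof -
  interpret prob_space "U y" using y by (rule prob_space_cell)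
  \<comment> \<open>The one-step value from \<open>z\<close> when the next state is rounded by
    \<open>Q\<close>: the sum is the integral of \<open>v \<circ> Q\<close> under the original
    kernel.\<close>
  define K where "K z = cost M (z, a) + \<beta> * (\<Sum>y'\<in>Y. measure (transition M (z, a)) (Q -` {y'}) * v y')" for z
  have c: "cost M \<in> borel_measurable (borel \<Otimes>\<^sub>M borel)"
    and tr: "transition M \<in> borel \<Otimes>\<^sub>M borel \<rightarrow>\<^sub>M prob_algebra borel" using M by (simp_all add: is_mdp_def)
  have mU: "g \<in> borel_measurable (U y) \<longleftrightarrow> g \<in> borel_measurable borel"
    and m\<nu>: "g \<in> borel_measurable \<nu> \<longleftrightarrow> g \<in> borel_measurable borel" for g :: "'z \<Rightarrow> real"
    by (simp_all add: measurable_cong_sets[OF sets_uniform_measure refl] measurable_cong_sets[OF nu(2) refl])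
  have mc: "(\<lambda>z. cost M (z, a)) \<in> borel_measurable borel" by (rule section_measurable[OF c])
  have mp: "(\<lambda>z. measure (transition M (z, a)) (Q -` {y'})) \<in> borel_measurable borel" if "y' \<in> Y" for y'
    using section_measurable[OF measurable_compose[OF tr measurable_measure_prob_algebra[OF cell_measurable[OF that]]]] .
  have le1: "measure (transition M (z, a)) A \<le> 1" for z A
    by (rule prob_space.prob_le_1[OF transition_prob(1)])
  have ip: "integrable (U y) (\<lambda>z. measure (transition M (z, a)) (Q -` {y'}))" if "y' \<in> Y" for y'
    using mp[OF that] le1 by (intro integrable_const_bound[where B=1]) (auto simp: mU)
  have ic: "integrable (U y) (\<lambda>z. cost M (z, a))"
  proof -
    from M(4) obtain B where "\<And>x. \<bar>cost M x\<bar> \<le> B" by (auto simp: bounded_iff)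
    then show ?thesis using mc by (intro integrable_const_bound[where B=B]) (auto simp: mU)
  qed
  have set_int: "(LINT z:Q -` {y}|U y. g z) = expectation g" if "g \<in> borel_measurable borel" for g :: "'z \<Rightarrow> real"
    using that cell_measurable[OF y] nu(2) by (intro integral_uniform_measure_cell) (auto simp: m\<nu>)
  have "bellman_residual M' \<beta> v (y, a) = expectation (\<lambda>z. cost M (z, a)) +
      \<beta> * (\<Sum>y'\<in>Y. expectation (\<lambda>z. measure (transition M (z, a)) (Q -` {y'})) * v y') - v y"
    using Y by (simp add: bellman_residual_def finite_model_def lebesgue_integral_point_measure_finite
        set_int mc mp cong: sum.cong)
  also have "\<dots> = expectation K - v y"
    unfolding K_def using ip ic
    by (subst Bochner_Integration.integral_add) (auto simp: Bochner_Integration.integral_sum intro!: integrable_mult_right integrable_mult_left integrable_sum)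
  finally have res: "bellman_residual M' \<beta> v (y, a) = expectation K - v y" .
  let ?G = "\<lambda>z. cost M (z, a) + \<beta> * (\<integral>y. v y \<partial>transition M (z, a))"
  have K: "\<bar>K z - ?G z\<bar> \<le> \<beta> * e" for z
  proof -
    interpret p: prob_space "transition M (z, a)" by (rule transition_prob)
    note sp = sets_eq_imp_space_eq[OF transition_prob(2)[of "(z, a)"], unfolded space_borel]
    have Qp: "Q \<in> transition M (z, a) \<rightarrow>\<^sub>M count_space Y"
      using Q by (simp add: measurable_cong_sets[OF transition_prob(2) refl])
    have mv: "v \<in> borel_measurable (transition M (z, a))"
      using v(1) by (simp add: measurable_cong_sets[OF transition_prob(2) refl])
    have mvQ: "(\<lambda>x. v (Q x)) \<in> borel_measurable (transition M (z, a))"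
      by (rule measurable_compose[OF Qp]) simp
    obtain b where b: "\<And>x. \<bar>v x\<bar> \<le> b" using v(2) by (auto simp: bounded_iff)
    have int: "integrable (transition M (z, a)) v" "integrable (transition M (z, a)) (\<lambda>x. v (Q x))"
      using b mv mvQ by (auto intro!: p.integrable_const_bound[where B=b])
    have "(\<Sum>y'\<in>Y. measure (transition M (z, a)) (Q -` {y'}) * v y') = p.expectation (\<lambda>x. v (Q x))"
      using integral_finite_range[OF p.finite_measure_axioms Y Qp, of v] by (simp add: sp mult.commute)
    then have eq: "K z - ?G z = \<beta> * (p.expectation (\<lambda>x. v (Q x) - v x) - 0)"
      by (simp add: K_def Bochner_Integration.integral_diff int algebra_simps)
    have "\<bar>p.expectation (\<lambda>x. v (Q x) - v x) - 0\<bar> \<le> e"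
      using e(1) mv mvQ by (intro p.abs_expectation_diff_le AE_I2) (auto simp: abs_minus_commute)
    then show ?thesis unfolding eq using \<beta> by (simp add: abs_mult)
  qed
  \<comment> \<open>On the cell \<open>?G (Q z) = ?G y\<close>, so the two error bounds add
    up.\<close>
  have "\<bar>K z - ?G y\<bar> \<le> (1 + \<beta>) * e" if "Q z = y" for z
    using K[of z] e(2)[of z a] that by (simp add: distrib_right)
  moreover have "K \<in> borel_measurable borel"
    unfolding K_def using mc mp by (intro borel_measurable_add borel_measurable_times borel_measurable_sum) auto
  ultimately have "\<bar>expectation K - ?G y\<bar> \<le> (1 + \<beta>) * e"
    by (intro abs_expectation_diff_le AE_cell y) (auto simp: mU)
  moreover have "bellman_residual M' \<beta> v (y, a) - bellman_residual M \<beta> v (y, a) = expectation K - ?G y"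
    unfolding res by (simp add: bellman_residual_def)
  ultimately show ?thesis by simp
qed


text \<open>The numerator bounds the residual of \<open>v\<close> along \<open>f \<circ> Q\<close>
  in the original model; dividing by \<open>1 - \<beta>\<close> accumulates it over time.\<close>

lemma quantized_policy_error:
  fixes v :: "'z \<Rightarrow> real"
  assumes \<beta>: "0 < \<beta>" "\<beta> < 1" and v: "v \<in> borel_measurable borel" "bounded (range v)"
    and bellman: "\<And>z a. 0 \<le> bellman_residual M \<beta> v (z, a)" "\<And>z. bellman_residual M \<beta> v (z, s z) = 0"
    and e0: "0 \<le> e"
    and e: "\<And>z. \<bar>v z - v (Q z)\<bar> \<le> e"
      "\<And>z a. \<bar>(cost M (z, a) + \<beta> * (\<integral>y. v y \<partial>transition M (z, a)))
        - (cost M (Q z, a) + \<beta> * (\<integral>y. v y \<partial>transition M (Q z, a)))\<bar> \<le> e"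
    and f: "optimal_stationary M' \<beta> f"
  shows "\<bar>discounted_cost M \<beta> (stationary M (f \<circ> Q)) z - value_function M \<beta> z\<bar> \<le>
    (2 * e + (1 + \<beta>) * e + 2 * ((1 + \<beta>) * e / (1 - \<beta>))) / (1 - \<beta>)"
proof -
  \<comment> \<open>The uniform gap between the residuals of the two models.\<close>
  define \<delta> where "\<delta> = (1 + \<beta>) * e"
  have \<delta>0: "0 \<le> \<delta>" using \<beta> e0 by (simp add: \<delta>_def)
  obtain V where V: "\<And>x. \<bar>v x\<bar> \<le> V" using v(2) by (auto simp: bounded_iff)
  obtain B where B: "\<And>x. \<bar>cost M x\<bar> \<le> B" and B': "\<And>x. x \<in> space (states M' \<Otimes>\<^sub>M actions M') \<Longrightarrow> \<bar>cost M' x\<bar> \<le> B"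
    using cost_bound by blast
  have sM': "states M' = count_space Y" "actions M' = borel" by (simp_all add: finite_model_def M)
  have fm: "f \<in> count_space Y \<rightarrow>\<^sub>M borel" using f by (simp add: optimal_stationary_def sM')
  note near = finite_model_residual[OF \<beta>(1) v e, folded \<delta>_def]
  have vM': "v \<in> borel_measurable (states M')" by (simp add: sM')
  have lower: "- \<delta> \<le> bellman_residual M' \<beta> v x" if "x \<in> space (states M' \<Otimes>\<^sub>M actions M')" for x
    using that near[of "fst x" "snd x"] bellman(1)[of "fst x" "snd x"] by (auto simp: sM' space_pair_measure)
  \<comment> \<open>The minimiser \<open>s\<close>, used on \<open>Y\<close>, competes with
    \<open>f\<close>: its residual vanishes in the original model, hence is at most
    \<open>\<delta>\<close> in the finite one.\<close>
  have f_cost: "discounted_cost M' \<beta> (stationary M' f) y \<le> v y + \<delta> / (1 - \<beta>)" if y: "y \<in> Y" for y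
  proof -
    have s: "s \<in> states M' \<rightarrow>\<^sub>M actions M'" by (simp add: sM')
    interpret P: stationary_process M' s y
      using is_mdp_finite_model s y by unfold_locales (simp_all add: sM')
    \<comment> \<open>A real infimum is a lower bound only for a set bounded below; the almost
      nonnegative residuals provide that bound.\<close>
    have "bdd_below ((\<lambda>\<pi>. discounted_cost M' \<beta> \<pi> y) ` policies M')"
    proof (rule bdd_belowI2)
      fix \<pi> assume "\<pi> \<in> policies M'"
      then interpret R: controlled_process M' \<pi> y
        using is_mdp_finite_model y by unfold_locales (simp_all add: sM')
      show "v y - \<delta> / (1 - \<beta>) \<le> discounted_cost M' \<beta> \<pi> y"
        using V by (intro R.discounted_cost_ge[OF \<beta> B' vM' _ lower]) auto
    qed
    then have "value_function M' \<beta> y \<le> discounted_cost M' \<beta> (stationary M' s) y"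
      unfolding value_function_def using stationary_policy[OF s] by (rule cINF_lower)
    also have "\<dots> \<le> v y + \<delta> / (1 - \<beta>)"
    proof (rule P.stationary_cost_le[OF \<beta> B' vM'])
      fix z assume "z \<in> space (states M')"
      then show "bellman_residual M' \<beta> v (z, s z) \<le> \<delta>"
        using near[of z "s z"] bellman(2)[of z] by (simp add: sM')
    qed (use V in auto)
    finally show ?thesis using f y by (simp add: optimal_stationary_def sM')
  qed
  \<comment> \<open>One \<open>\<delta> / (1 - \<beta>)\<close> comes from \<open>f_cost\<close>,
    the other from the slack in \<open>lower\<close>; the single \<open>\<delta>\<close> returns to
    the original model, and \<open>2 * e\<close> moves from \<open>Q z\<close> to \<open>z\<close>,
    once in \<open>v\<close> and once in the one-step value.\<close>
  define \<eta> where "\<eta> = 2 * e + \<delta> + 2 * (\<delta> / (1 - \<beta>))"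
  have res: "bellman_residual M \<beta> v (z, (f \<circ> Q) z) \<le> \<eta>" for z
  proof -
    let ?y = "Q z"
    interpret P: stationary_process M' f ?y
      using is_mdp_finite_model fm Q_in by unfold_locales (simp_all add: sM')
    have "bellman_residual M' \<beta> v (?y, f ?y) \<le> discounted_cost M' \<beta> (stationary M' f) ?y - v ?y + \<delta> / (1 - \<beta>)"
      using V by (intro P.stationary_residual_le[OF \<beta> B' vM' _ \<delta>0 lower]) auto
    with f_cost[OF Q_in, of z] near[OF Q_in, of z "f ?y"]
    have "bellman_residual M \<beta> v (?y, f ?y) \<le> \<delta> + 2 * (\<delta> / (1 - \<beta>))" by linarith
    with e(1)[of z] e(2)[of z "f ?y"] show ?thesis
      unfolding bellman_residual_def \<eta>_def comp_def fst_conv by linarith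
  qed
  have fQ: "f \<circ> Q \<in> states M \<rightarrow>\<^sub>M actions M"
    using measurable_comp[OF Q fm] by (simp add: M)
  interpret P: stationary_process M "f \<circ> Q" z
    using M fQ by unfold_locales simp_all
  have vM: "v \<in> borel_measurable (states M)" using v M by simp
  have ge: "v z \<le> discounted_cost M \<beta> \<pi> z" if "\<pi> \<in> policies M" for \<pi>
  proof -
    interpret R: controlled_process M \<pi> z
      using M that by unfold_locales simp_all
    have "v z - 0 / (1 - \<beta>) \<le> discounted_cost M \<beta> \<pi> z"
      using V bellman(1) by (intro R.discounted_cost_ge[OF \<beta> B vM]) auto
    then show ?thesis by simp
  qed
  \<comment> \<open>Both the value function and the cost of \<open>f \<circ> Q\<close> are
    sandwiched between \<open>v z\<close> and \<open>v z + \<eta> / (1 - \<beta>)\<close>.\<close>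
  have "discounted_cost M \<beta> (stationary M (f \<circ> Q)) z \<le> v z + \<eta> / (1 - \<beta>)"
    using V res by (intro P.stationary_cost_le[OF \<beta> B vM]) auto
  moreover have "v z \<le> value_function M \<beta> z"
    unfolding value_function_def using ge P.policy by (intro cINF_greatest) auto
  moreover have "value_function M \<beta> z \<le> discounted_cost M \<beta> (stationary M (f \<circ> Q)) z"
    unfolding value_function_def using ge P.policy by (intro cINF_lower bdd_belowI2) auto
  ultimately show ?thesis unfolding \<eta>_def \<delta>_def by linarith
qed

end

section \<open>Convergence as the mesh shrinks\<close>

theorem theorem2p2:
  fixes M :: "('z::polish_space, 'a::polish_space) mdp"
    and \<beta> :: real
    and Zn :: "nat \<Rightarrow> 'z set"
    and Q :: "nat \<Rightarrow> 'z \<Rightarrow> 'z"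
    and \<nu> :: "nat \<Rightarrow> 'z measure"
    and f :: "nat \<Rightarrow> 'z \<Rightarrow> 'a"
  assumes mdp: "is_mdp M" "states M = borel" "actions M = borel"
    and compact_spaces: "compact (UNIV :: 'z set)" "compact (UNIV :: 'a set)"
    and cost: "continuous_on UNIV (cost M)" "bounded (range (cost M))"
    and kernel: "weakly_continuous_kernel (transition M)"
    and discount: "0 < \<beta>" "\<beta> < 1"
    and net: "\<And>n. n \<ge> 1 \<Longrightarrow> finite (Zn n) \<and> Zn n \<noteq> {}"
      "\<And>n z. n \<ge> 1 \<Longrightarrow> Min (dist z ` Zn n) < 1 / real n"
    and quantizer: "\<And>n. n \<ge> 1 \<Longrightarrow> Q n \<in> borel \<rightarrow>\<^sub>M count_space (Zn n)"
      "\<And>n z. n \<ge> 1 \<Longrightarrow> is_arg_min (dist z) (\<lambda>y. y \<in> Zn n) (Q n z)"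
    and weights: "\<And>n. n \<ge> 1 \<Longrightarrow> prob_space (\<nu> n) \<and> sets (\<nu> n) = sets borel"
      "\<And>n y. n \<ge> 1 \<Longrightarrow> y \<in> Zn n \<Longrightarrow> measure (\<nu> n) (Q n -` {y}) > 0"
    and optimal: "\<And>n. n \<ge> 1 \<Longrightarrow>
      optimal_stationary (finite_model M (Zn n) (Q n) (\<nu> n)) \<beta> (f n)"
  shows "(\<lambda>n. SUP z. \<bar>discounted_cost M \<beta> (stationary M (f n \<circ> Q n)) z - value_function M \<beta> z\<bar>)
    \<longlonglongrightarrow> 0"
proof -
  obtain v s where v: "continuous_on UNIV v"
    and bellman: "\<And>z a. 0 \<le> bellman_residual M \<beta> v (z, a)" "\<And>z. bellman_residual M \<beta> v (z, s z) = 0"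
    using Bellman_equation_solution[OF mdp compact_spaces cost(1) kernel discount] by blast
  have v': "v \<in> borel_measurable borel" "bounded (range v)"
    using borel_measurable_continuous_onI[OF v]
      compact_imp_bounded[OF compact_continuous_image[OF v compact_spaces(1)]] by auto
  \<comment> \<open>The residual without its \<open>- v\<close> term; its uniform continuity absorbs
    the quantization of the current state.\<close>
  define G where "G x = cost M x + \<beta> * (\<integral>y. v y \<partial>transition M x)" for x
  have "continuous_on UNIV G"
    unfolding G_def by (intro continuous_intros cost continuous_on_kernel_integral kernel v v')
  then have Gu: "uniformly_continuous_on UNIV G"
    using compact_uniformly_continuous[of UNIV G] compact_Times[OF compact_spaces] by simp
  have vu: "uniformly_continuous_on UNIV v"
    by (rule compact_uniformly_continuous[OF v compact_spaces(1)])
  \<comment> \<open>The minimum is attained at some point of the net, and \<open>Q n z\<close> is no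
    farther from \<open>z\<close> than that point.\<close>
  have dist_Q: "dist z (Q n z) < 1 / real n" if n: "n \<ge> 1" for n z
  proof -
    have "Min (dist z ` Zn n) \<in> dist z ` Zn n" using net(1)[OF n] by (intro Min_in) auto
    then obtain y where "y \<in> Zn n" "dist z y < 1 / real n" using net(2)[OF n, of z] by auto
    with quantizer(2)[OF n, of z] show ?thesis
      unfolding is_arg_min_def by (meson le_less_trans not_less)
  qed
  \<comment> \<open>The bound of \<open>quantized_policy_error\<close> with the factor
    \<open>e\<close> taken out.\<close>
  define C where "C = (2 + (1 + \<beta>) + 2 * ((1 + \<beta>) / (1 - \<beta>))) / (1 - \<beta>)"
  have C: "C > 0" unfolding C_def using discount by (intro divide_pos_pos add_pos_nonneg) auto
  show ?thesis
  proof (rule LIMSEQ_I)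
    fix r :: real assume r: "0 < r"
    \<comment> \<open>Chosen so that \<open>C * e = r / 2\<close>: the inequality stays strict after
      passing to the supremum.\<close>
    define e where "e = r / (2 * C)"
    have e: "e > 0" using r C by (simp add: e_def)
    obtain d1 where d1: "d1 > 0" "\<And>x y. dist x y < d1 \<Longrightarrow> dist (v x) (v y) < e"
      using vu e unfolding uniformly_continuous_on_def by (metis UNIV_I dist_commute)
    obtain d2 where d2: "d2 > 0" "\<And>x y. dist x y < d2 \<Longrightarrow> dist (G x) (G y) < e"
      using Gu e unfolding uniformly_continuous_on_def by (metis UNIV_I dist_commute)
    obtain k :: nat where k: "1 / real (Suc k) < min d1 d2"
      using nat_approx_posE[of "min d1 d2"] d1(1) d2(1) by auto
    have "norm ((SUP z. \<bar>discounted_cost M \<beta> (stationary M (f n \<circ> Q n)) z - value_function M \<beta> z\<bar>) - 0) < r"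
      if n: "n \<ge> Suc k" for n
    proof -
      have n1: "n \<ge> 1" using n by simp
      interpret quantized_mdp M "Zn n" "Q n" "\<nu> n"
        using mdp cost net(1)[OF n1] quantizer(1)[OF n1] weights(1)[OF n1] weights(2)[OF n1]
        by (intro quantized_mdp.intro) auto
      have "1 / real n \<le> 1 / real (Suc k)" using n by (intro divide_left_mono) auto
      with k have d: "dist z (Q n z) < d1" "dist z (Q n z) < d2" for z
        using dist_Q[OF n1, of z] by simp_all
      have ev: "\<bar>v z - v (Q n z)\<bar> \<le> e" for z
        using d1(2)[OF d(1)[of z]] by (simp add: dist_real_def)
      \<comment> \<open>Pairs sharing the action are exactly as far apart as their states.\<close>
      have eG: "\<bar>G (z, a) - G (Q n z, a)\<bar> \<le> e" for z a
        using d2(2)[of "(z, a)" "(Q n z, a)"] d(2)[of z] by (simp add: dist_Pair_Pair dist_real_def)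
      have bound: "\<bar>discounted_cost M \<beta> (stationary M (f n \<circ> Q n)) z - value_function M \<beta> z\<bar> \<le> C * e" for z
        using quantized_policy_error[OF discount v' bellman less_imp_le[OF e] ev eG[unfolded G_def] optimal[OF n1], of z]
        by (simp add: C_def algebra_simps add_divide_distrib diff_divide_distrib)
      let ?S = "SUP z. \<bar>discounted_cost M \<beta> (stationary M (f n \<circ> Q n)) z - value_function M \<beta> z\<bar>"
      have "?S \<le> C * e" using bound by (intro cSUP_least) auto
      \<comment> \<open>The supremum dominates the absolute value at an arbitrary state, here
        \<open>undefined\<close>; \<open>bound\<close> supplies the boundedness above that a real
        supremum requires.\<close>
      moreover have "0 \<le> ?S"
        using bound by (intro order_trans[OF abs_ge_zero cSUP_upper[of undefined]] bdd_aboveI2[where M="C * e"]) auto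
      moreover have "C * e < r" using r C by (simp add: e_def)
      ultimately show ?thesis by simp
    qed
    then show "\<exists>no. \<forall>n\<ge>no. norm ((SUP z. \<bar>discounted_cost M \<beta> (stationary M (f n \<circ> Q n)) z - value_function M \<beta> z\<bar>) - 0) < r"
      by blast
  qed
qed

end
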